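(* Let $\beta>1$ be irrational and let $n,m\ge 2$ be integers. Then for every irrational $\beta'>1$ with $\beta'\neq\beta$ we have $\mu_{(\beta,n)}\neq\mu_{(\beta',m)}$.
   Context: For a real number $\gamma>1$ let $T_\gamma:[0,1)\to[0,1)$, $T_\gamma(x)=\gamma x \bmod 1$. For real $\beta>1$ and an integer $n\ge 2$, the alternate base transformation $K_{(\beta,n)}:\{0,1\}\times[0,1)\to\{0,1\}\times[0,1)$ is $K_{(\beta,n)}(0,x)=(1,T_\beta(x))$, $K_{(\beta,n)}(1,x)=(0,T_n(x))$. For reals $\gamma_1,\gamma_2>1$, $T_{\gamma_1\circ\gamma_2}:=T_{\gamma_1}\circ T_{\gamma_2}$ (a piecewise linear map of constant slope $\gamma_1\gamma_2$), and $\mu_{\gamma_1\circ\gamma_2}$ denotes its unique invariant probability measure absolutely continuous with respect to Lebesgue measure. The absolutely continuous invariant probability measure $\mu_{(\beta,n)}$ of $K_{(\beta,n)}$ is given by $\mu_{(\beta,n)}(\{0\}\times A\cup\{1\}\times B)=\tfrac12\mu_{n\circ\beta}(A)+\tfrac12\mu_{\beta\circ n}(B)$ for Borel $A,B\subseteq[0,1)$. *)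

theory Defs
  imports "HOL-Probability.Probability"
begin

definition unit_leb :: "real measure" where
  "unit_leb = restrict_space lborel {0..<1}"

definition T_map :: "real \<Rightarrow> real \<Rightarrow> real" where
  "T_map \<gamma> x = frac (\<gamma> * x)"

definition acim :: "(real \<Rightarrow> real) \<Rightarrow> real measure \<Rightarrow> bool" where
  "acim T M \<longleftrightarrow> sets M = sets unit_leb \<and> prob_space M
     \<and> absolutely_continuous unit_leb M \<and> T \<in> measurable M M \<and> distr M M T = M"

definition mu_comp :: "real \<Rightarrow> real \<Rightarrow> real measure" where
  "mu_comp \<gamma>1 \<gamma>2 = (THE M. acim (T_map \<gamma>1 \<circ> T_map \<gamma>2) M)"

definition mu_alt :: "real \<Rightarrow> nat \<Rightarrow> (nat \<times> real) measure" where
  "mu_alt \<beta> n = measure_of ({0,1} \<times> {0..<1})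
     (sets (count_space {0::nat,1} \<Otimes>\<^sub>M unit_leb))
     (\<lambda>S. (1/2) * emeasure (mu_comp (real n) \<beta>) {x. (0, x) \<in> S}
        + (1/2) * emeasure (mu_comp \<beta> (real n)) {x. (1, x) \<in> S})"

end

theory Submission
  imports Defs
begin

text \<open>
  Since \<open>n\<close> is an integer, \<open>T\<^sub>n \<circ> T\<^sub>\<beta> = T\<^sub>\<gamma>\<close> with \<open>\<gamma> = n \<beta> > 2\<close>, so \<open>\<mu>\<close> of \<open>n \<circ> \<beta>\<close> has
  Parry's density \<open>h = C\<inverse> \<Sum>\<^sub>k \<gamma>\<^sup>-\<^sup>k 1\<^bsub>[0, t k)\<^esub>\<close> with \<open>t k = T\<^sub>\<gamma>\<^sup>k 1\<close>, and \<open>\<mu>\<close> of \<open>\<beta> \<circ> n\<close> is its image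
  under \<open>T\<^sub>\<beta>\<close>, with a density \<open>g\<close> jumping at the points \<open>s k = frac (\<beta> t k)\<close>.

  Uniqueness: for \<open>B\<^sub>k = T\<^sub>\<gamma>\<^sup>-\<^sup>k A\<close> the discrepancy \<open>D a = |[0,a) \<inter> B\<^sub>k| - a \<mu>(A)\<close> obeys a linear
  recursion in \<open>k\<close>, and invariance of \<open>\<mu>\<close> says \<open>\<Sum>\<^sub>j \<gamma>\<^sup>-\<^sup>j D (t j) = 0\<close>. As \<open>\<gamma> > 2\<close>, the term \<open>j = 0\<close>
  is bounded by \<open>1 / (\<gamma> - 1) < 1\<close> times the supremum of \<open>|D|\<close>, which gives exponential decay of \<open>D\<close>,
  hence mixing against every integrable function.

  Comparison: let both measures agree for \<open>\<beta> < \<beta>'\<close>. From \<open>h(1-)\<close> the constants \<open>C\<close> agree, from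
  \<open>h(0)\<close> the sums \<open>S = \<Sum> {\<gamma>\<^sup>-\<^sup>k | t k > 0}\<close> agree, and from \<open>g(0) - g(1-)\<close> the quotients \<open>W / \<beta>\<close> agree,
  where \<open>W = \<Sum> {\<gamma>\<^sup>-\<^sup>k | s k > 0} \<le> S\<close>. Hence \<open>W < S\<close> for \<open>\<beta>\<close>, so the orbit of 1 under \<open>T\<^sub>\<gamma>\<close> is finite,
  \<open>S = W + \<gamma>\<^sup>-\<^sup>k\<close>, and \<open>\<beta>' \<le> \<beta> S / W < \<beta> + 1\<close>. Then \<open>frac \<beta>' \<noteq> frac \<beta>\<close>, so the jump of \<open>g\<close> at
  \<open>frac \<beta>'\<close>, which is at least \<open>1 / (\<beta>' C)\<close>, is at most \<open>(W - 1) / (\<beta> C)\<close>; this is impossible.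
\<close>

section \<open>The maps and Lebesgue measure\<close>

lemma frac_measurable [measurable]: "frac \<in> borel_measurable (borel :: real measure)"
  unfolding frac_def by measurable

lemma T_map_measurable_borel [measurable]: "T_map \<gamma> \<in> borel_measurable borel"
  unfolding T_map_def by measurable

lemma space_unit_leb [simp]: "space unit_leb = {0..<1}"
  by (simp add: unit_leb_def space_restrict_space)

lemma sets_unit_leb_iff: "A \<in> sets unit_leb \<longleftrightarrow> A \<in> sets borel \<and> A \<subseteq> {0..<1}"
  by (auto simp: unit_leb_def sets_restrict_space_iff)

lemma emeasure_unit_leb: "A \<in> sets unit_leb \<Longrightarrow> emeasure unit_leb A = emeasure lborel A"
  unfolding unit_leb_def by (subst emeasure_restrict_space) (auto simp: sets_restrict_space_iff)

lemma prob_space_unit_leb: "prob_space unit_leb"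
  by (rule prob_spaceI) (simp add: emeasure_unit_leb sets_unit_leb_iff)

interpretation U: prob_space unit_leb
  by (rule prob_space_unit_leb)

lemma T_map_range: "T_map \<gamma> x \<in> {0..<1}"
  by (simp add: T_map_def frac_lt_1)

lemma T_map_measurable [measurable]: "T_map \<gamma> \<in> measurable unit_leb unit_leb"
  unfolding unit_leb_def
  by (intro measurable_restrict_space3) (auto simp: T_map_range[unfolded atLeastLessThan_iff])

text \<open>Induction that splits off the leftmost unit cell: on [0,1) the set is \<open>A\<close>
  itself, and beyond 1 it is the previous set shifted by 1. The partial cell of length
  \<open>f\<close> stays at the right end.\<close>

lemma emeasure_frac_vimage:
  assumes f: "0 \<le> f" "f \<le> 1" and A: "A \<in> sets unit_leb"
  shows "emeasure lborel ({0..<real N + f} \<inter> frac -` A)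
    = of_nat N * emeasure lborel A + emeasure lborel ({0..<f} \<inter> A)"
proof (induction N)
  case 0
  have "{0..<f} \<inter> frac -` A = {0..<f} \<inter> A"
    using f by (auto simp: frac_eq[THEN iffD2])
  then show ?case by simp
next
  case (Suc N)
  have A': "A \<in> sets borel" "A \<subseteq> {0..<1}" using A by (auto simp: sets_unit_leb_iff)
  let ?R = "{0..<real N + f} \<inter> frac -` A"
  let ?V = "(+) (-1) -` ?R"
  have fr: "frac (x - 1) = frac x" for x :: real
    using frac_1_eq[of "x - 1"] by simp
  have R: "?R \<in> sets borel"
    using A' measurable_sets[OF frac_measurable, of A] by auto
  have V: "?V \<in> sets borel"
    using measurable_sets[of "(+) (-1::real)" borel borel ?R] R by simp
  have eq: "{0..<real (Suc N) + f} \<inter> frac -` A = A \<union> ?V"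
  proof (rule set_eqI)
    fix x :: real
    show "x \<in> {0..<real (Suc N) + f} \<inter> frac -` A \<longleftrightarrow> x \<in> A \<union> ?V"
    proof (cases "0 \<le> x \<and> x < 1")
      case True
      then show ?thesis using f by (auto simp: frac_eq[THEN iffD2])
    next
      case False
      then show ?thesis using A' fr[of x] by (auto simp: algebra_simps)
    qed
  qed
  have "emeasure lborel (A \<union> ?V) = emeasure lborel A + emeasure lborel ?V"
    by (rule plus_emeasure[symmetric]) (use A' V in auto)
  also have "emeasure lborel ?V = emeasure (distr lborel borel ((+) (-1))) ?R"
    using R by (subst emeasure_distr) auto
  also have "\<dots> = emeasure lborel ?R"
    by (simp only: lborel_distr_plus)
  finally show ?case
    unfolding eq Suc by (simp only: of_nat_Suc distrib_right add.assoc mult_1_left)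
qed

text \<open>Scaling by \<gamma> turns [0,a) into [0, \<gamma> a), which consists of full unit cells,
  each containing a whole copy of \<open>A\<close>, and one partial cell of length
  \<open>frac (\<gamma> * a)\<close>.\<close>

lemma measure_T_map_vimage:
  assumes g: "\<gamma> > 0" and a: "0 \<le> a" "a \<le> 1" and A: "A \<in> sets unit_leb"
  shows "measure unit_leb ({0..<a} \<inter> T_map \<gamma> -` A)
    = (of_int \<lfloor>\<gamma> * a\<rfloor> * measure unit_leb A
        + measure unit_leb ({0..<frac (\<gamma> * a)} \<inter> A)) / \<gamma>"
proof -
  define N where "N = nat \<lfloor>\<gamma> * a\<rfloor>"
  have N: "real N = of_int \<lfloor>\<gamma> * a\<rfloor>" using g a by (simp add: N_def)
  have Na: "real N + frac (\<gamma> * a) = \<gamma> * a" by (simp add: N frac_def)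
  let ?R = "{0..<\<gamma> * a} \<inter> frac -` A"
  have A': "A \<in> sets borel" "A \<subseteq> {0..<1}" using A by (auto simp: sets_unit_leb_iff)
  have R: "?R \<in> sets borel"
    using A' measurable_sets[OF frac_measurable, of A] by auto
  have eq: "{0..<a} \<inter> T_map \<gamma> -` A = (*) \<gamma> -` ?R"
    using g by (auto simp: T_map_def zero_le_mult_iff)
  have S: "{0..<a} \<inter> T_map \<gamma> -` A \<in> sets unit_leb"
    using measurable_sets[OF T_map_measurable_borel, of A \<gamma>] A' a
    by (auto simp: sets_unit_leb_iff)
  have "emeasure unit_leb ({0..<a} \<inter> T_map \<gamma> -` A) = emeasure lborel ((*) \<gamma> -` ?R)"
    by (subst emeasure_unit_leb[OF S]) (simp only: eq)
  also have "\<dots> = emeasure (distr lborel borel ((*) \<gamma>)) ?R"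
    using R by (subst emeasure_distr) auto
  also have "\<dots> = ennreal (inverse \<gamma>) * emeasure lborel ?R"
    using g R by (subst lborel_distr_mult) (auto simp: emeasure_density nn_integral_cmult)
  also have "emeasure lborel ?R = of_nat N * emeasure lborel A
      + emeasure lborel ({0..<frac (\<gamma> * a)} \<inter> A)"
    using emeasure_frac_vimage[of "frac (\<gamma> * a)" A N] A
    by (simp add: Na frac_lt_1 less_imp_le)
  also have "emeasure lborel A = emeasure unit_leb A"
    using A by (simp add: emeasure_unit_leb)
  also have "emeasure lborel ({0..<frac (\<gamma> * a)} \<inter> A) = emeasure unit_leb ({0..<frac (\<gamma> * a)} \<inter> A)"
    using A' by (subst emeasure_unit_leb) (auto simp: sets_unit_leb_iff)
  finally have "ennreal (measure unit_leb ({0..<a} \<inter> T_map \<gamma> -` A))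
     = ennreal (inverse \<gamma> * (real N * measure unit_leb A
         + measure unit_leb ({0..<frac (\<gamma> * a)} \<inter> A)))"
    using g by (simp add: U.emeasure_eq_measure ennreal_mult'' ennreal_of_nat_eq_real_of_nat)
  then show ?thesis
    using g by (subst (asm) ennreal_inj) (auto simp: N[symmetric] field_simps)
qed

lemma measure_unit_leb_interval:
  "0 \<le> a \<Longrightarrow> a \<le> 1 \<Longrightarrow> measure unit_leb {0..<a} = a"
  by (simp add: measure_def emeasure_unit_leb sets_unit_leb_iff)

section \<open>The Parry measure\<close>

text \<open>The orbit starts at the point 1 outside [0,1), so that [0,
  \<open>orb \<gamma> 0\<close>) is the whole space. If it reaches 0 it stays there, and the later
  steps of the density are empty.\<close>

definition orb :: "real \<Rightarrow> nat \<Rightarrow> real" where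
  "orb \<gamma> k = (T_map \<gamma> ^^ k) 1"

definition parry_const :: "real \<Rightarrow> real" where
  "parry_const \<gamma> = (\<Sum>k. orb \<gamma> k / \<gamma> ^ k)"

text \<open>The series is taken in the extended nonnegative reals and so has a value at every point
  without a convergence proof. \<open>parry_const\<close> is the total mass of the unnormalised
  density, since [0, \<open>orb \<gamma> k\<close>) has length
  \<open>orb \<gamma> k\<close>.\<close>

definition parry :: "real \<Rightarrow> real measure" where
  "parry \<gamma> = density unit_leb
     (\<lambda>x. \<Sum>k. ennreal (1 / (parry_const \<gamma> * \<gamma> ^ k)) * indicator {0..<orb \<gamma> k} x)"

lemma orb_0 [simp]: "orb \<gamma> 0 = 1"
  by (simp add: orb_def)

lemma orb_Suc: "orb \<gamma> (Suc k) = frac (\<gamma> * orb \<gamma> k)"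
  by (simp add: orb_def T_map_def)

lemma orb_nonneg: "0 \<le> orb \<gamma> k"
  by (cases k) (auto simp: orb_Suc)

lemma orb_Suc_less_1: "orb \<gamma> (Suc k) < 1"
  by (simp add: orb_Suc frac_lt_1)

lemma orb_le_1: "orb \<gamma> k \<le> 1"
  by (cases k) (auto simp: orb_Suc_less_1 less_imp_le)

lemma summable_geometric_bounded:
  fixes f :: "nat \<Rightarrow> real"
  assumes "\<gamma> > 1" "\<And>k. \<bar>f k\<bar> \<le> B"
  shows "summable (\<lambda>k. f k / \<gamma> ^ k)"
proof (rule summable_comparison_test')
  show "summable (\<lambda>k. B * (1 / \<gamma>) ^ k)"
    using assms(1) by (intro summable_mult summable_geometric) auto
  show "norm (f k / \<gamma> ^ k) \<le> B * (1 / \<gamma>) ^ k" if "k \<ge> 0" for k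
    using assms by (simp add: power_divide divide_right_mono)
qed

lemma summable_orb: "\<gamma> > 1 \<Longrightarrow> summable (\<lambda>k. orb \<gamma> k / \<gamma> ^ k)"
  by (rule summable_geometric_bounded[where B = 1]) (auto simp: orb_nonneg orb_le_1)

lemma parry_const_pos: 
  assumes "\<gamma> > 1"
  shows "parry_const \<gamma> > 0"
proof -
  have "orb \<gamma> 0 / \<gamma> ^ 0 \<le> parry_const \<gamma>"
    unfolding parry_const_def using assms sum_le_suminf[OF summable_orb[OF assms], of "{0}"]
    by (auto simp: orb_nonneg)
  then show ?thesis by simp
qed

text \<open>The greedy expansion of 1 in base \<gamma>: the floors are its digits, and the partial
  sums telescope to 1 minus a vanishing remainder.\<close>

lemma orb_digits_sums:
  assumes g: "\<gamma> > 1"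
  shows "(\<lambda>k. of_int \<lfloor>\<gamma> * orb \<gamma> k\<rfloor> / \<gamma> ^ Suc k) sums 1"
proof -
  have "(\<lambda>k. orb \<gamma> k / \<gamma> ^ k) \<longlonglongrightarrow> 0"
    by (rule summable_LIMSEQ_zero[OF summable_orb[OF g]])
  then have "(\<lambda>k. orb \<gamma> k / \<gamma> ^ k - orb \<gamma> (Suc k) / \<gamma> ^ Suc k) sums (orb \<gamma> 0 / \<gamma> ^ 0 - 0)"
    by (rule telescope_sums')
  moreover have "orb \<gamma> k / \<gamma> ^ k - orb \<gamma> (Suc k) / \<gamma> ^ Suc k = of_int \<lfloor>\<gamma> * orb \<gamma> k\<rfloor> / \<gamma> ^ Suc k" for k
    using g by (simp add: orb_Suc frac_def field_simps)
  ultimately show ?thesis by simp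
qed

lemma sets_parry [simp, measurable_cong]: "sets (parry \<gamma>) = sets unit_leb"
  by (simp add: parry_def)

lemma space_parry [simp]: "space (parry \<gamma>) = {0..<1}"
  by (simp add: parry_def)

lemma sets_unit_leb_interval: "b \<le> 1 \<Longrightarrow> {0..<b} \<in> sets unit_leb"
  by (auto simp: sets_unit_leb_iff)

lemma emeasure_parry:
  assumes A: "A \<in> sets unit_leb" and g: "\<gamma> > 1"
  shows "emeasure (parry \<gamma>) A
    = ennreal ((\<Sum>k. measure unit_leb ({0..<orb \<gamma> k} \<inter> A) / \<gamma> ^ k) / parry_const \<gamma>)"
proof -
  let ?C = "parry_const \<gamma>"
  have C: "?C > 0" using g by (rule parry_const_pos)
  have B: "{0..<orb \<gamma> k} \<inter> A \<in> sets unit_leb" for k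
    using A sets_unit_leb_interval[OF orb_le_1] by auto
  have [measurable]: "(\<lambda>x. \<Sum>k. ennreal (1 / (?C * \<gamma> ^ k)) * indicator {0..<orb \<gamma> k} x)
      \<in> borel_measurable unit_leb"
    by (intro borel_measurable_suminf_order borel_measurable_times_ennreal borel_measurable_const
        borel_measurable_indicator sets_unit_leb_interval orb_le_1)
  have S: "summable (\<lambda>k. measure unit_leb ({0..<orb \<gamma> k} \<inter> A) / \<gamma> ^ k)"
    by (rule summable_geometric_bounded[where B = 1]) (use g in auto)
  have "emeasure (parry \<gamma>) A
    = (\<integral>\<^sup>+x. (\<Sum>k. ennreal (1 / (?C * \<gamma> ^ k)) * indicator ({0..<orb \<gamma> k} \<inter> A) x) \<partial>unit_leb)"
    unfolding parry_def using A
    by (subst emeasure_density) (auto simp: ennreal_suminf_multc[symmetric] indicator_inter_arith mult.assoc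
        intro!: nn_integral_cong)
  also have "\<dots> = (\<Sum>k. \<integral>\<^sup>+x. ennreal (1 / (?C * \<gamma> ^ k)) * indicator ({0..<orb \<gamma> k} \<inter> A) x \<partial>unit_leb)"
    by (intro nn_integral_suminf borel_measurable_times_ennreal borel_measurable_const
        borel_measurable_indicator B)
  also have "\<dots> = (\<Sum>k. ennreal (measure unit_leb ({0..<orb \<gamma> k} \<inter> A) / \<gamma> ^ k / ?C))"
    using B C g by (intro suminf_cong, subst nn_integral_cmult_indicator)
      (auto simp: U.emeasure_eq_measure ennreal_mult''[symmetric] mult.commute)
  also have "\<dots> = ennreal (\<Sum>k. measure unit_leb ({0..<orb \<gamma> k} \<inter> A) / \<gamma> ^ k / ?C)"
    using C g by (intro suminf_ennreal2 summable_divide S) auto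
  also have "\<dots> = ennreal ((\<Sum>k. measure unit_leb ({0..<orb \<gamma> k} \<inter> A) / \<gamma> ^ k) / ?C)"
    by (simp only: suminf_divide[OF S])
  finally show ?thesis .
qed

lemma measure_parry:
  assumes A: "A \<in> sets unit_leb" and g: "\<gamma> > 1"
  shows "measure (parry \<gamma>) A
    = (\<Sum>k. measure unit_leb ({0..<orb \<gamma> k} \<inter> A) / \<gamma> ^ k) / parry_const \<gamma>"
proof -
  have "summable (\<lambda>k. measure unit_leb ({0..<orb \<gamma> k} \<inter> A) / \<gamma> ^ k)"
    by (rule summable_geometric_bounded[where B = 1]) (use g in auto)
  then have "0 \<le> (\<Sum>k. measure unit_leb ({0..<orb \<gamma> k} \<inter> A) / \<gamma> ^ k) / parry_const \<gamma>"
    using g parry_const_pos[OF g] by (intro divide_nonneg_pos suminf_nonneg) auto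
  then show ?thesis
    by (simp add: measure_def emeasure_parry[OF assms] del: divide_nonneg_nonneg)
qed

lemma prob_space_parry:
  assumes g: "\<gamma> > 1"
  shows "prob_space (parry \<gamma>)"
proof (rule prob_spaceI)
  have "measure unit_leb ({0..<orb \<gamma> k} \<inter> {0..<1}) = orb \<gamma> k" for k
  proof -
    have "{0..<orb \<gamma> k} \<inter> {0..<1} = {0..<orb \<gamma> k}" using orb_le_1[of \<gamma> k] by auto
    then show ?thesis by (simp add: measure_unit_leb_interval orb_nonneg orb_le_1)
  qed
  then show "emeasure (parry \<gamma>) (space (parry \<gamma>)) = 1"
    using emeasure_parry[of "{0..<1}" \<gamma>] g parry_const_pos[OF g]
    by (simp add: sets_unit_leb_interval parry_const_def[symmetric])
qed

lemma T_map_vimage_sets: "A \<in> sets unit_leb \<Longrightarrow> T_map \<gamma> -` A \<inter> {0..<1} \<in> sets unit_leb"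
  using measurable_sets[OF T_map_measurable, of A \<gamma>] by simp

lemma Int_vimage_unit:
  "a \<le> 1 \<Longrightarrow> {0..<a} \<inter> (B \<inter> {0..<1}) = {0..<a} \<inter> (B :: real set)"
  by auto

text \<open>The slope \<beta> is kept independent of \<gamma>: the case \<beta> = \<gamma> gives
  invariance, and the general case gives the image measure under
  \<open>T_map \<beta>\<close>.\<close>

lemma measure_parry_vimage:
  assumes A: "A \<in> sets unit_leb" and g: "\<gamma> > 1" and b: "\<beta> > 0"
  shows "measure (parry \<gamma>) (T_map \<beta> -` A \<inter> {0..<1})
    = (\<Sum>k. (of_int \<lfloor>\<beta> * orb \<gamma> k\<rfloor> * measure unit_leb A
        + measure unit_leb ({0..<frac (\<beta> * orb \<gamma> k)} \<inter> A)) / \<gamma> ^ k) / (\<beta> * parry_const \<gamma>)"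
    (is "?L = (\<Sum>k. ?f k / \<gamma> ^ k) / _")
proof -
  have "?L = (\<Sum>k. ?f k / \<beta> / \<gamma> ^ k) / parry_const \<gamma>"
    unfolding measure_parry[OF T_map_vimage_sets[OF A] g] Int_vimage_unit[OF orb_le_1]
      measure_T_map_vimage[OF b orb_nonneg orb_le_1 A] ..
  also have "(\<lambda>k. ?f k / \<beta> / \<gamma> ^ k) = (\<lambda>k. ?f k / \<gamma> ^ k / \<beta>)"
    by (simp add: mult.commute)
  also have "summable (\<lambda>k. ?f k / \<gamma> ^ k)"
  proof (rule summable_geometric_bounded[OF g])
    fix k
    have 1: "of_int \<lfloor>\<beta> * orb \<gamma> k\<rfloor> \<le> \<beta>"
      using b mult_left_mono[OF orb_le_1[of \<gamma> k], of \<beta>]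
      by (intro order_trans[OF of_int_floor_le]) simp
    have 2: "0 \<le> real_of_int \<lfloor>\<beta> * orb \<gamma> k\<rfloor>" using b by (simp add: orb_nonneg)
    have "of_int \<lfloor>\<beta> * orb \<gamma> k\<rfloor> * measure unit_leb A \<le> \<beta> * 1"
      using 1 2 b by (intro mult_mono) auto
    then show "\<bar>?f k\<bar> \<le> \<beta> + 1" using 2 U.prob_le_1 
      by (subst abs_of_nonneg) (auto intro!: add_mono)
  qed
  then have "(\<Sum>k. ?f k / \<gamma> ^ k / \<beta>) = (\<Sum>k. ?f k / \<gamma> ^ k) / \<beta>"
    by (rule suminf_divide)
  finally show ?thesis by (simp add: divide_simps)
qed

text \<open>Pulling back replaces [0, \<open>orb \<gamma> k\<close>) by full copies of
  \<open>A\<close> and the piece on [0, \<open>orb \<gamma> (Suc k)\<close>). The pieces are the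
  terms of index at least 1 of the original series, and by the expansion of 1 the full copies add up
  to the missing term of index 0.\<close>

lemma parry_invariant:
  assumes A: "A \<in> sets unit_leb" and g: "\<gamma> > 1"
  shows "measure (parry \<gamma>) (T_map \<gamma> -` A \<inter> {0..<1}) = measure (parry \<gamma>) A"
proof -
  let ?m = "\<lambda>k. measure unit_leb ({0..<orb \<gamma> k} \<inter> A)"
  have A1: "{0..<1} \<inter> A = A" using A by (auto simp: sets_unit_leb_iff)
  have S: "summable (\<lambda>k. ?m k / \<gamma> ^ k)"
    by (rule summable_geometric_bounded[where B = 1]) (use g in auto)
  have S': "summable (\<lambda>k. ?m (Suc k) / \<gamma> ^ Suc k)"
    using S by (subst summable_Suc_iff[where f = "\<lambda>k. ?m k / \<gamma> ^ k"])
  have "(\<lambda>k. of_int \<lfloor>\<gamma> * orb \<gamma> k\<rfloor> / \<gamma> ^ Suc k * measure unit_leb A + ?m (Suc k) / \<gamma> ^ Suc k) sums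
      (1 * measure unit_leb A + (\<Sum>k. ?m (Suc k) / \<gamma> ^ Suc k))"
    by (intro sums_add sums_mult2 orb_digits_sums g summable_sums S')
  also have "1 * measure unit_leb A + (\<Sum>k. ?m (Suc k) / \<gamma> ^ Suc k) = (\<Sum>k. ?m k / \<gamma> ^ k)"
    using suminf_split_head[OF S] A1 by simp
  also have "(\<lambda>k. of_int \<lfloor>\<gamma> * orb \<gamma> k\<rfloor> / \<gamma> ^ Suc k * measure unit_leb A + ?m (Suc k) / \<gamma> ^ Suc k)
    = (\<lambda>k. (of_int \<lfloor>\<gamma> * orb \<gamma> k\<rfloor> * measure unit_leb A + ?m (Suc k)) / \<gamma> ^ k * (1 / \<gamma>))"
    by (simp add: add_divide_distrib algebra_simps)
  finally have "(\<lambda>k. (of_int \<lfloor>\<gamma> * orb \<gamma> k\<rfloor> * measure unit_leb A + ?m (Suc k)) / \<gamma> ^ k * (1 / \<gamma>) * \<gamma>)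
     sums ((\<Sum>k. ?m k / \<gamma> ^ k) * \<gamma>)"
    by (rule sums_mult2)
  then have "(\<Sum>k. (of_int \<lfloor>\<gamma> * orb \<gamma> k\<rfloor> * measure unit_leb A + ?m (Suc k)) / \<gamma> ^ k)
     = (\<Sum>k. ?m k / \<gamma> ^ k) * \<gamma>"
    using g by (intro sums_unique[symmetric]) simp
  then show ?thesis
    using g unfolding measure_parry[OF A g] by (subst measure_parry_vimage[OF A g]) (auto simp: orb_Suc)
qed

section \<open>Mixing and uniqueness\<close>

definition discrepancy :: "real \<Rightarrow> real set \<Rightarrow> real \<Rightarrow> real" where
  "discrepancy \<gamma> B a = measure unit_leb ({0..<a} \<inter> B) - a * measure (parry \<gamma>) B"

text \<open>The split \<gamma> a = floor + fractional part applies both to the preimage and to the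
  subtracted term, whose measure is unchanged by invariance.\<close>

lemma discrepancy_vimage:
  assumes g: "\<gamma> > 1" and B: "B \<in> sets unit_leb" and a: "0 \<le> a" "a \<le> 1"
  shows "discrepancy \<gamma> (T_map \<gamma> -` B \<inter> {0..<1}) a
    = (of_int \<lfloor>\<gamma> * a\<rfloor> * discrepancy \<gamma> B 1 + discrepancy \<gamma> B (frac (\<gamma> * a))) / \<gamma>"
proof -
  have B1: "{0..<1} \<inter> B = B" using B by (auto simp: sets_unit_leb_iff)
  have "\<gamma> > 0" using g by simp
  then show ?thesis
    using a by (simp add: discrepancy_def Int_vimage_unit measure_T_map_vimage[OF _ _ _ B]
        parry_invariant[OF B g] B1 frac_def field_simps)
qed

text \<open>The series formula for \<open>parry \<gamma>\<close> rearranged: the weighted Lebesgue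
  measures add up to \<open>parry_const \<gamma>\<close> times the measure of \<open>B\<close>, and
  so do the subtracted terms by the definition of \<open>parry_const\<close>.\<close>

lemma discrepancy_orb_sums:
  assumes g: "\<gamma> > 1" and B: "B \<in> sets unit_leb"
  shows "(\<lambda>k. discrepancy \<gamma> B (orb \<gamma> k) / \<gamma> ^ k) sums 0"
proof -
  let ?c = "measure (parry \<gamma>) B"
  have S: "summable (\<lambda>k. measure unit_leb ({0..<orb \<gamma> k} \<inter> B) / \<gamma> ^ k)"
    by (rule summable_geometric_bounded[where B = 1]) (use g in auto)
  have "(\<lambda>k. measure unit_leb ({0..<orb \<gamma> k} \<inter> B) / \<gamma> ^ k - orb \<gamma> k / \<gamma> ^ k * ?c)
     sums ((\<Sum>k. measure unit_leb ({0..<orb \<gamma> k} \<inter> B) / \<gamma> ^ k) - parry_const \<gamma> * ?c)"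
    unfolding parry_const_def
    by (intro sums_diff sums_mult2 summable_sums S summable_orb g)
  also have "(\<Sum>k. measure unit_leb ({0..<orb \<gamma> k} \<inter> B) / \<gamma> ^ k) - parry_const \<gamma> * ?c = 0"
    using parry_const_pos[OF g] by (simp add: measure_parry[OF B g])
  finally show ?thesis
    by (simp add: discrepancy_def diff_divide_distrib)
qed

text \<open>The term of index 0 in the vanishing series is the discrepancy at 1, so it is bounded by
  the geometric tail of the other terms.\<close>

lemma discrepancy_1_le:
  assumes g: "\<gamma> > 1" and B: "B \<in> sets unit_leb"
    and D: "\<And>a. 0 \<le> a \<Longrightarrow> a \<le> 1 \<Longrightarrow> \<bar>discrepancy \<gamma> B a\<bar> \<le> s"
  shows "\<bar>discrepancy \<gamma> B 1\<bar> \<le> s / (\<gamma> - 1)"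
proof -
  let ?D = "discrepancy \<gamma> B"
  have Do: "\<bar>?D (orb \<gamma> k)\<bar> \<le> s" for k by (rule D[OF orb_nonneg orb_le_1])
  have geo: "(\<lambda>k. s / \<gamma> * (1 / \<gamma>) ^ k) sums (s / \<gamma> * (1 / (1 - 1 / \<gamma>)))"
    using g by (intro sums_mult geometric_sums) auto
  have sumD: "summable (\<lambda>k. ?D (orb \<gamma> k) / \<gamma> ^ k)"
    using discrepancy_orb_sums[OF g B] by (rule sums_summable)
  have "?D 1 = - (\<Sum>k. ?D (orb \<gamma> (Suc k)) / \<gamma> ^ Suc k)"
    using suminf_split_head[OF sumD] sums_unique[OF discrepancy_orb_sums[OF g B]] by simp
  also have "\<bar>\<dots>\<bar> \<le> (\<Sum>k. s / \<gamma> * (1 / \<gamma>) ^ k)"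
  proof -
    have "norm (\<Sum>k. ?D (orb \<gamma> (Suc k)) / \<gamma> ^ Suc k) \<le> (\<Sum>k. s / \<gamma> * (1 / \<gamma>) ^ k)"
    proof (rule norm_suminf_le)
      show "summable (\<lambda>k. s / \<gamma> * (1 / \<gamma>) ^ k)" using geo by (rule sums_summable)
      show "norm (?D (orb \<gamma> (Suc k)) / \<gamma> ^ Suc k) \<le> s / \<gamma> * (1 / \<gamma>) ^ k" for k
        using g Do[of "Suc k"] by (simp add: power_divide divide_right_mono)
    qed
    then show ?thesis by simp
  qed
  also have "\<dots> = s / (\<gamma> - 1)"
    using g sums_unique[OF geo] by (simp add: field_simps)
  finally show ?thesis .
qed

text \<open>The affine majorant \<open>u a + v\<close> contracts under the dynamics. A plain supremum bound would
  not, since the partial last branch contributes up to a further \<open>1 / \<gamma>\<close>.\<close>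

lemma discrepancy_contract:
  assumes g: "\<gamma> > 2" and B: "B \<in> sets unit_leb" and uv: "0 \<le> u" "0 \<le> v"
    and \<theta>: "\<theta> = 1 / (\<gamma> - 1)" "\<theta> * (u + v) \<le> u"
    and D: "\<And>a. 0 \<le> a \<Longrightarrow> a \<le> 1 \<Longrightarrow> \<bar>discrepancy \<gamma> B a\<bar> \<le> u * a + v"
    and a: "0 \<le> a" "a \<le> 1"
  shows "\<bar>discrepancy \<gamma> (T_map \<gamma> -` B \<inter> {0..<1}) a\<bar> \<le> \<theta> * (u + v) * a + (1 - \<theta>) * (u + v) / \<gamma>"
proof -
  have g1: "\<gamma> > 1" using g by simp
  let ?D = "discrepancy \<gamma> B" and ?X = "\<theta> * (u + v)" and ?f = "frac (\<gamma> * a)"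
  have "u * a' + v \<le> u + v" if "a' \<le> 1" for a' 
    using mult_left_mono[OF that uv(1)] by simp
  then have "\<bar>?D a'\<bar> \<le> u + v" if "0 \<le> a'" "a' \<le> 1" for a'
    using D[OF that] that by (meson order_trans)
  then have X: "\<bar>?D 1\<bar> \<le> ?X"
    using discrepancy_1_le[OF g1 B, of "u + v"] by (simp add: \<theta>)
  have f: "0 \<le> ?f" "?f \<le> 1" by (auto simp: frac_lt_1 less_imp_le)
  have fl: "of_int \<lfloor>\<gamma> * a\<rfloor> = \<gamma> * a - ?f" by (simp add: frac_def)
  have n: "0 \<le> \<gamma> * a - ?f" unfolding fl[symmetric] using g a by simp
  have "\<bar>of_int \<lfloor>\<gamma> * a\<rfloor> * ?D 1 + ?D ?f\<bar> \<le> (\<gamma> * a - ?f) * ?X + (u * ?f + v)"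
    using D[OF f] mult_left_mono[OF X n] n unfolding fl
    by (intro order_trans[OF abs_triangle_ineq] add_mono) (simp_all add: abs_mult)
  also have "\<dots> = \<gamma> * a * ?X + (u - ?X) * ?f + v" by (simp add: algebra_simps)
  \<comment> \<open>The hypothesis \<open>\<theta> * (u + v) \<le> u\<close> makes the coefficient
    of the fractional part nonnegative, so 1 may replace that part. The constant left over is u + v
    - \<theta> (u + v).\<close>
  also have "\<dots> \<le> \<gamma> * a * ?X + (u - ?X) * 1 + v"
    using \<theta>(2) mult_left_mono[OF f(2), of "u - ?X"] by simp
  also have "\<dots> = \<gamma> * (?X * a + (1 - \<theta>) * (u + v) / \<gamma>)"
    using g by (simp add: field_simps)
  finally have "\<bar>of_int \<lfloor>\<gamma> * a\<rfloor> * ?D 1 + ?D ?f\<bar> / \<gamma> \<le> ?X * a + (1 - \<theta>) * (u + v) / \<gamma>"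
    using g by (simp add: pos_divide_le_eq mult.commute)
  then show ?thesis
    using g discrepancy_vimage[OF g1 B a] by simp
qed

section \<open>Iterated preimages and exponential decay of the discrepancy\<close>

definition vimage_iter :: "real \<Rightarrow> nat \<Rightarrow> real set \<Rightarrow> real set" where
  "vimage_iter \<gamma> k = ((\<lambda>B. T_map \<gamma> -` B \<inter> {0..<1}) ^^ k)"

lemma vimage_iter_0 [simp]: "vimage_iter \<gamma> 0 A = A"
  by (simp add: vimage_iter_def)

lemma vimage_iter_Suc [simp]: "vimage_iter \<gamma> (Suc k) A = T_map \<gamma> -` (vimage_iter \<gamma> k A) \<inter> {0..<1}"
  by (simp add: vimage_iter_def)

lemma vimage_iter_sets: "A \<in> sets unit_leb \<Longrightarrow> vimage_iter \<gamma> k A \<in> sets unit_leb"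
  by (induction k) (auto intro: T_map_vimage_sets)

lemma measure_parry_vimage_iter:
  "A \<in> sets unit_leb \<Longrightarrow> \<gamma> > 1 \<Longrightarrow> measure (parry \<gamma>) (vimage_iter \<gamma> k A) = measure (parry \<gamma>) A"
  by (induction k) (auto simp: parry_invariant vimage_iter_sets)

text \<open>The trivial bound has u = 1, v = 0; one contraction turns it into u = \<theta>, v = (1 -
  \<theta>) / \<gamma>, with sum \<kappa>. The new majorant depends on u + v only, so each further
  step multiplies it by \<kappa>. The index \<open>Suc k\<close> accounts for the first
  contraction.\<close>

lemma discrepancy_decay:
  assumes g: "\<gamma> > 2" and A: "A \<in> sets unit_leb" and a: "0 \<le> a" "a \<le> 1"
    and \<theta>: "\<theta> = 1 / (\<gamma> - 1)" and \<kappa>: "\<kappa> = \<theta> + (1 - \<theta>) / \<gamma>"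
  shows "\<bar>discrepancy \<gamma> (vimage_iter \<gamma> (Suc k) A) a\<bar> \<le> \<theta> * \<kappa> ^ k * a + (1 - \<theta>) * \<kappa> ^ k / \<gamma>"
  using a
proof (induction k arbitrary: a)
  case 0
  interpret P: prob_space "parry \<gamma>" using g by (intro prob_space_parry) simp
  have \<theta>1: "0 < \<theta>" "\<theta> < 1" using g by (auto simp: \<theta>)
  have "\<bar>discrepancy \<gamma> A a\<bar> \<le> 1 * a + 0" if a: "0 \<le> a" "a \<le> 1" for a
  proof -
    have "measure unit_leb ({0..<a} \<inter> A) \<le> measure unit_leb {0..<a}"
      using a by (intro U.finite_measure_mono sets_unit_leb_interval) auto
    moreover have "a * measure (parry \<gamma>) A \<le> a"
      using a by (simp add: mult_left_le)
    moreover have "0 \<le> a * measure (parry \<gamma>) A" using a by simp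
    moreover have "0 \<le> measure unit_leb ({0..<a} \<inter> A)" by simp
    ultimately show ?thesis
      unfolding discrepancy_def measure_unit_leb_interval[OF a] by linarith
  qed
  from discrepancy_contract[OF g A _ _ \<theta> _ this 0] show ?case using \<theta>1 by simp
next
  case (Suc k)
  have \<theta>1: "0 < \<theta>" "\<theta> < 1" using g by (auto simp: \<theta>)
  have \<kappa>0: "\<kappa> \<ge> 0" using \<theta>1 g by (simp add: \<kappa>)
  have "(1 - \<theta>) / \<gamma> \<le> 1 - \<theta>" using \<theta>1 g by (simp add: divide_le_eq)
  then have \<kappa>1: "\<kappa> \<le> 1" by (simp add: \<kappa>)
  have s: "\<theta> * \<kappa> ^ k + (1 - \<theta>) * \<kappa> ^ k / \<gamma> = \<kappa> ^ Suc k"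
    by (simp add: \<kappa> algebra_simps add_divide_distrib diff_divide_distrib)
  \<comment> \<open>This is the side condition \<open>\<theta> * (u + v) \<le> u\<close> of the
    contraction for the current majorant.\<close>
  have "\<theta> * \<kappa> ^ Suc k \<le> \<theta> * \<kappa> ^ k"
    using \<theta>1 \<kappa>0 \<kappa>1 by (intro mult_left_mono power_decreasing) auto
  then show ?case
    using discrepancy_contract[OF g vimage_iter_sets[OF A] _ _ \<theta> _ Suc.IH Suc.prems] \<theta>1 \<kappa>0 g
    unfolding s vimage_iter_Suc by simp
qed

lemma interval_mixing:
  assumes g: "\<gamma> > 2" and A: "A \<in> sets unit_leb" and a: "0 \<le> a" "a \<le> 1"
  shows "(\<lambda>k. measure unit_leb ({0..<a} \<inter> vimage_iter \<gamma> k A)) \<longlonglongrightarrow> a * measure (parry \<gamma>) A"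
proof -
  define \<theta> where "\<theta> = 1 / (\<gamma> - 1)"
  define \<kappa> where "\<kappa> = \<theta> + (1 - \<theta>) / \<gamma>"
  have \<theta>1: "0 < \<theta>" "\<theta> < 1" using g by (auto simp: \<theta>_def)
  have \<kappa>0: "\<kappa> \<ge> 0" using \<theta>1 g by (simp add: \<kappa>_def)
  have "(1 - \<theta>) / \<gamma> < 1 - \<theta>" using \<theta>1 g by (simp add: divide_less_eq)
  then have \<kappa>1: "\<kappa> < 1" by (simp add: \<kappa>_def)
  have p: "(\<lambda>k. \<kappa> ^ k) \<longlonglongrightarrow> 0" using \<kappa>0 \<kappa>1 by (simp add: LIMSEQ_power_zero)
  have lim: "(\<lambda>k. \<theta> * \<kappa> ^ k * a + (1 - \<theta>) * \<kappa> ^ k / \<gamma>) \<longlonglongrightarrow> \<theta> * 0 * a + (1 - \<theta>) * 0 / \<gamma>"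
    using g by (intro tendsto_add tendsto_mult tendsto_divide tendsto_const p) auto
  have "(\<lambda>k. discrepancy \<gamma> (vimage_iter \<gamma> (Suc k) A) a) \<longlonglongrightarrow> 0"
    by (rule Lim_null_comparison[OF always_eventually])
      (use lim discrepancy_decay[OF g A a \<theta>_def \<kappa>_def] in auto)
  then have "(\<lambda>k. discrepancy \<gamma> (vimage_iter \<gamma> k A) a) \<longlonglongrightarrow> 0"
    by (rule LIMSEQ_imp_Suc)
  then show ?thesis
    using measure_parry_vimage_iter[OF A, of \<gamma>] g
    by (simp add: discrepancy_def LIM_zero_cancel)
qed

text \<open>Dynkin's lemma from half-lines. The generators live on the whole line and complements
  are taken in \<open>UNIV\<close>, hence the intersection with [0,1) in the limit.\<close>

lemma set_mixing:
  assumes g: "\<gamma> > 2" and A: "A \<in> sets unit_leb" and X: "X \<in> sets borel"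
  shows "(\<lambda>k. measure unit_leb (X \<inter> vimage_iter \<gamma> k A))
    \<longlonglongrightarrow> measure unit_leb (X \<inter> {0..<1}) * measure (parry \<gamma>) A"
proof -
  let ?B = "\<lambda>k. vimage_iter \<gamma> k A" and ?c = "measure (parry \<gamma>) A"
  have B: "?B k \<in> sets unit_leb" "?B k \<subseteq> {0..<1}" for k
    using vimage_iter_sets[OF A, of \<gamma> k] by (auto simp: sets_unit_leb_iff)
  have XB: "Y \<inter> ?B k \<in> sets unit_leb" if "Y \<in> sets borel" for Y k
    using that B[of k] by (auto simp: sets_unit_leb_iff)
  have X1: "Y \<inter> {0..<1} \<in> sets unit_leb" if "Y \<in> sets borel" for Y
    using that by (auto simp: sets_unit_leb_iff)
  have sb: "sigma_sets UNIV (range lessThan) = sets (borel :: real measure)"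
    by (simp add: borel_Iio)
  have IS: "Int_stable (range lessThan :: real set set)"
    by (rule Int_stableI_image, rule_tac x = "min i j" in bexI) auto
  have sp: "range lessThan \<subseteq> Pow (UNIV :: real set)" by simp
  have X': "X \<in> sigma_sets UNIV (range lessThan)" using X by (simp add: sb)
  show ?thesis
    using IS sp X'
  proof (induction rule: sigma_sets_induct_disjoint)
    case (basic Y)
    then obtain a where Y: "Y = {..<a}" by auto
    define b where "b = max 0 (min a 1)"
    have b: "0 \<le> b" "b \<le> 1" by (auto simp: b_def)
    have "Y \<inter> ?B k = {0..<b} \<inter> ?B k" for k
      using B[of k] by (auto simp: Y b_def)
    moreover have "Y \<inter> {0..<1} = {0..<b}" by (auto simp: Y b_def)
    ultimately show ?case
      using interval_mixing[OF g A b] b by (simp add: measure_unit_leb_interval)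
  next
    case empty
    then show ?case by simp
  next
    case (compl Y)
    then have Y: "Y \<in> sets borel" by (simp add: sb)
    have 1: "measure unit_leb ((UNIV - Y) \<inter> ?B k) = measure unit_leb ({0..<1} \<inter> ?B k) - measure unit_leb (Y \<inter> ?B k)" for k
    proof -
      have "(UNIV - Y) \<inter> ?B k = {0..<1} \<inter> ?B k - (Y \<inter> ?B k)" using B[of k] by auto
      then show ?thesis using XB[OF Y, of k] B[of k]
        by (simp, subst U.finite_measure_Diff) (auto simp: Int_absorb1)
    qed
    have 2: "measure unit_leb ((UNIV - Y) \<inter> {0..<1}) = 1 - measure unit_leb (Y \<inter> {0..<1})"
    proof -
      have "(UNIV - Y) \<inter> {0..<1} = space unit_leb - Y \<inter> {0..<1}" by auto
      then show ?thesis using X1[OF Y] by (simp only: U.prob_compl)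
    qed
    show ?case unfolding 1 2 left_diff_distrib
      by (intro tendsto_diff compl.IH interval_mixing g A) auto
  next
    case (union Y)
    then have Y: "Y i \<in> sets borel" for i by (auto simp: sb)
    have dj: "disjoint_family (\<lambda>i. Y i \<inter> Z)" for Z
      using union(1) by (auto simp: disjoint_family_on_def)
    have sums: "(\<lambda>i. measure unit_leb (Y i \<inter> Z)) sums measure unit_leb ((\<Union>i. Y i) \<inter> Z)"
      if "Z \<in> sets unit_leb" for Z
    proof -
      have "(\<lambda>i. measure unit_leb (Y i \<inter> Z)) sums measure unit_leb (\<Union>i. Y i \<inter> Z)"
        using that Y by (intro U.finite_measure_UNION dj) (auto simp: sets_unit_leb_iff)
      then show ?thesis by (simp add: Int_UN_distrib2)
    qed
    have U1: "{0..<1} \<in> sets unit_leb" by (simp add: sets_unit_leb_iff)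
    \<comment> \<open>Limit and countable sum may be exchanged because the measures of the
      \<open>Y i\<close> within [0,1) form a summable majorant that does not depend on
      \<open>k\<close>.\<close>
    have "(\<lambda>k. \<Sum>i. measure unit_leb (Y i \<inter> ?B k)) \<longlonglongrightarrow> (\<Sum>i. measure unit_leb (Y i \<inter> {0..<1}) * ?c)"
    proof (rule tannerys_theorem[THEN conjunct2, THEN conjunct2])
      show "summable (\<lambda>i. measure unit_leb (Y i \<inter> {0..<1}))"
        using sums[OF U1] by (rule sums_summable)
      show "\<forall>\<^sub>F (i, k) in at_top \<times>\<^sub>F sequentially.
          norm (measure unit_leb (Y i \<inter> ?B k)) \<le> measure unit_leb (Y i \<inter> {0..<1})"
        using B Y by (intro always_eventually)
          (auto intro!: U.finite_measure_mono X1)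
    qed (use union in auto)
    moreover have "(\<Sum>i. measure unit_leb (Y i \<inter> {0..<1}) * ?c) = measure unit_leb ((\<Union>i. Y i) \<inter> {0..<1}) * ?c"
      by (rule sums_unique[symmetric], rule sums_mult2, rule sums[OF U1])
    moreover have "(\<Sum>i. measure unit_leb (Y i \<inter> ?B k)) = measure unit_leb ((\<Union>i. Y i) \<inter> ?B k)" for k
      by (rule sums_unique[symmetric], rule sums[OF B(1)])
    ultimately show ?case by simp
  qed
qed

text \<open>Simple functions follow from \<open>set_mixing\<close>. For the limit case,
  approximation in the L1 norm is uniform in \<open>k\<close>, since the indicators and the measure
  of \<open>A\<close> are at most 1, so an argument with e / 3 closes it.\<close>

lemma integral_mixing:
  fixes f :: "real \<Rightarrow> real"
  assumes g: "\<gamma> > 2" and A: "A \<in> sets unit_leb" and f: "integrable unit_leb f"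
  shows "(\<lambda>k. \<integral>x. f x * indicator (vimage_iter \<gamma> k A) x \<partial>unit_leb)
    \<longlonglongrightarrow> (\<integral>x. f x \<partial>unit_leb) * measure (parry \<gamma>) A"
  using f
proof (induction rule: integrable_induct)
  case (base X c)
  have X: "X \<in> sets borel" "X \<inter> {0..<1} = X" using base by (auto simp: sets_unit_leb_iff)
  have L: "(\<lambda>k. c * measure unit_leb (X \<inter> vimage_iter \<gamma> k A)) \<longlonglongrightarrow> c * (measure unit_leb (X \<inter> {0..<1}) * measure (parry \<gamma>) A)"
    by (intro tendsto_mult_left set_mixing g A X)
  have I1: "(\<integral>x. (indicator X x *\<^sub>R c) * indicator (vimage_iter \<gamma> k A) x \<partial>unit_leb)
     = c * measure unit_leb (X \<inter> vimage_iter \<gamma> k A)" for k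
  proof -
    have "(\<integral>x. (indicator X x *\<^sub>R c) * indicator (vimage_iter \<gamma> k A) x \<partial>unit_leb)
       = (\<integral>x. c * indicator (X \<inter> vimage_iter \<gamma> k A) x \<partial>unit_leb)"
      by (intro Bochner_Integration.integral_cong) (auto simp: indicator_def)
    also have "\<dots> = c * measure unit_leb (X \<inter> vimage_iter \<gamma> k A)"
    proof -
      have "X \<inter> vimage_iter \<gamma> k A \<inter> {0..<1} = X \<inter> vimage_iter \<gamma> k A" using X by blast
      then show ?thesis by simp
    qed
    finally show ?thesis .
  qed
  have I2: "(\<integral>x. indicator X x *\<^sub>R c \<partial>unit_leb) = c * measure unit_leb (X \<inter> {0..<1})"
    using base X by simp
  show ?case unfolding I1 I2 using L by (simp only: mult.assoc)
next
  case (add f h)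
  have B: "vimage_iter \<gamma> k A \<in> sets unit_leb" for k by (rule vimage_iter_sets[OF A])
  have "integrable unit_leb (\<lambda>x. f x * indicator (vimage_iter \<gamma> k A) x)"
    "integrable unit_leb (\<lambda>x. h x * indicator (vimage_iter \<gamma> k A) x)" for k
    using add.hyps B[of k] by (auto intro!: integrable_real_mult_indicator)
  then show ?case
    using tendsto_add[OF add.IH] add.hyps by (simp add: distrib_right)
next
  case (lim f s)
  let ?c = "measure (parry \<gamma>) A"
  let ?I = "\<lambda>f k. \<integral>x. f x * indicator (vimage_iter \<gamma> k A) x \<partial>unit_leb"
  interpret P: prob_space "parry \<gamma>" using g by (intro prob_space_parry) simp
  have B: "vimage_iter \<gamma> k A \<in> sets unit_leb" for k by (rule vimage_iter_sets[OF A])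
  have int: "integrable unit_leb (\<lambda>x. h x * indicator (vimage_iter \<gamma> k A) x)"
    if "integrable unit_leb h" for h :: "real \<Rightarrow> real" and k
    using that B[of k] by (auto intro!: integrable_real_mult_indicator)
  let ?d = "\<lambda>i. \<integral>x. \<bar>s i x - f x\<bar> \<partial>unit_leb"
  have "?d \<longlonglongrightarrow> (\<integral>x. 0 \<partial>unit_leb)"
  proof (rule integral_dominated_convergence)
    \<comment> \<open>The approximants satisfy |s i x| \<le> 2 |f x|, so the difference is at most 3
      |f x|.\<close>
    show "integrable unit_leb (\<lambda>x. 3 * \<bar>f x\<bar>)" using lim.hyps by auto
    show "AE x in unit_leb. (\<lambda>i. \<bar>s i x - f x\<bar>) \<longlonglongrightarrow> 0"
    proof (rule AE_I2)
      fix x assume "x \<in> space unit_leb"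
      then have "(\<lambda>i. s i x - f x) \<longlonglongrightarrow> 0" using lim.hyps(2) by (simp add: LIM_zero)
      then show "(\<lambda>i. \<bar>s i x - f x\<bar>) \<longlonglongrightarrow> 0" by (simp add: tendsto_rabs_zero)
    qed
    show "AE x in unit_leb. norm \<bar>s i x - f x\<bar> \<le> 3 * \<bar>f x\<bar>" for i
    proof (rule AE_I2)
      fix x assume "x \<in> space unit_leb"
      from lim.hyps(3)[OF this, of i] show "norm \<bar>s i x - f x\<bar> \<le> 3 * \<bar>f x\<bar>" by auto
    qed
  qed (use lim.hyps in auto)
  then have d: "?d \<longlonglongrightarrow> 0" by simp
  have diff: "\<bar>?I f k - ?I (s i) k\<bar> \<le> ?d i" for i k
  proof -
    have "?I f k - ?I (s i) k = (\<integral>x. (f x - s i x) * indicator (vimage_iter \<gamma> k A) x \<partial>unit_leb)"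
      using int[OF lim.hyps(4)] int[OF lim.hyps(1)] by (simp add: left_diff_distrib)
    also have "\<bar>\<dots>\<bar> \<le> (\<integral>x. \<bar>(f x - s i x) * indicator (vimage_iter \<gamma> k A) x\<bar> \<partial>unit_leb)"
      by (rule integral_abs_bound)
    also have "\<dots> \<le> ?d i"
      using lim.hyps(1,4) B[of k]
      by (intro integral_mono integrable_abs int Bochner_Integration.integrable_diff)
         (auto simp: indicator_def abs_minus_commute)
    finally show ?thesis .
  qed
  have diff2: "\<bar>(\<integral>x. f x \<partial>unit_leb) * ?c - (\<integral>x. s i x \<partial>unit_leb) * ?c\<bar> \<le> ?d i" for i
  proof -
    have "\<bar>(\<integral>x. f x \<partial>unit_leb) - (\<integral>x. s i x \<partial>unit_leb)\<bar> = \<bar>\<integral>x. f x - s i x \<partial>unit_leb\<bar>"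
      using lim.hyps(1,4) by simp
    also have "\<dots> \<le> (\<integral>x. \<bar>f x - s i x\<bar> \<partial>unit_leb)" by (rule integral_abs_bound)
    also have "\<dots> = ?d i" by (simp add: abs_minus_commute)
    finally have "\<bar>(\<integral>x. f x \<partial>unit_leb) - (\<integral>x. s i x \<partial>unit_leb)\<bar> * ?c \<le> ?d i * 1"
      by (intro mult_mono) auto
    then show ?thesis by (simp add: left_diff_distrib[symmetric] abs_mult)
  qed
  show ?case
  proof (rule LIMSEQ_I)
    fix e :: real assume e: "e > 0"
    obtain i where i: "?d i < e / 3"
      using order_tendstoD(2)[OF d, of "e / 3"] e by (auto simp: eventually_sequentially)
    obtain N where N: "\<And>k. k \<ge> N \<Longrightarrow> \<bar>?I (s i) k - (\<integral>x. s i x \<partial>unit_leb) * ?c\<bar> < e / 3"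
      using LIMSEQ_D[OF lim.IH[of i], of "e / 3"] e by auto
    show "\<exists>N. \<forall>k\<ge>N. norm (?I f k - (\<integral>x. f x \<partial>unit_leb) * ?c) < e"
    proof (intro exI allI impI)
      fix k assume "k \<ge> N"
      from N[OF this] diff[of k i] diff2[of i] i
      show "norm (?I f k - (\<integral>x. f x \<partial>unit_leb) * ?c) < e" unfolding real_norm_def by linarith
    qed
  qed
qed

section \<open>Existence and uniqueness of the absolutely continuous invariant measure\<close>

lemma acim_parry:
  assumes g: "\<gamma> > 1"
  shows "acim (T_map \<gamma>) (parry \<gamma>)"
proof -
  interpret P: prob_space "parry \<gamma>" using g by (rule prob_space_parry)
  have T: "T_map \<gamma> \<in> measurable (parry \<gamma>) (parry \<gamma>)"
    using T_map_measurable by (simp cong: measurable_cong_sets)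
  have "distr (parry \<gamma>) (parry \<gamma>) (T_map \<gamma>) = parry \<gamma>"
  proof (rule measure_eqI)
    fix A assume "A \<in> sets (distr (parry \<gamma>) (parry \<gamma>) (T_map \<gamma>))"
    then show "emeasure (distr (parry \<gamma>) (parry \<gamma>) (T_map \<gamma>)) A = emeasure (parry \<gamma>) A"
      using T parry_invariant[OF _ g, of A] by (simp add: emeasure_distr P.emeasure_eq_measure)
  qed simp
  moreover have "absolutely_continuous unit_leb (parry \<gamma>)"
  proof (unfold absolutely_continuous_def, rule subsetI)
    fix A assume N: "A \<in> null_sets unit_leb"
    have "measure unit_leb ({0..<orb \<gamma> k} \<inter> A) = 0" for k
    proof -
      have "{0..<orb \<gamma> k} \<inter> A \<in> null_sets unit_leb"
        using N by (intro null_set_Int1 sets_unit_leb_interval orb_le_1)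
      then show ?thesis by (simp add: measure_def null_sets_def)
    qed
    then show "A \<in> null_sets (parry \<gamma>)"
      using N emeasure_parry[OF _ g, of A] by (auto simp: null_sets_def)
  qed
  ultimately show ?thesis
    using T P.prob_space_axioms by (simp add: acim_def)
qed

text \<open>Integrating the density of \<open>M\<close> over the k-th preimage of \<open>A\<close>
  gives the measure of \<open>A\<close> under \<open>M\<close> for every \<open>k\<close> by
  invariance, and tends to its measure under \<open>parry \<gamma>\<close> by mixing. Hence the two
  agree.\<close>

lemma acim_unique:
  assumes g: "\<gamma> > 2" and M: "acim (T_map \<gamma>) M"
  shows "M = parry \<gamma>"
proof -
  have sM: "sets M = sets unit_leb" and ac: "absolutely_continuous unit_leb M"
    and T: "T_map \<gamma> \<in> measurable M M" and inv: "distr M M (T_map \<gamma>) = M" and pM: "prob_space M"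
    using M by (auto simp: acim_def)
  interpret M: prob_space M by (rule pM)
  interpret P: prob_space "parry \<gamma>" using g by (intro prob_space_parry) simp
  have spM: "space M = {0..<1}" using sets_eq_imp_space_eq[OF sM] by simp
  obtain D where D: "D \<in> borel_measurable unit_leb"
    "AE x in unit_leb. RN_deriv unit_leb M x = ennreal (D x)" "\<And>x. 0 \<le> D x"
    using U.real_RN_deriv[OF M.finite_measure_axioms ac sM] by metis
  have "M = density unit_leb (RN_deriv unit_leb M)"
    by (rule U.density_RN_deriv[OF ac sM, symmetric])
  also have "\<dots> = density unit_leb (\<lambda>x. ennreal (D x))"
    using D by (intro density_cong) auto
  finally have MD: "M = density unit_leb (\<lambda>x. ennreal (D x))" .
  have meas: "measure M A = (\<integral>x. D x * indicator A x \<partial>unit_leb)" if A: "A \<in> sets unit_leb" for A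
  proof -
    have "measure M A = (\<integral>x. indicator A x \<partial>M)"
      using A by (simp add: sM sets.sets_into_space Int_absorb2)
    also have "\<dots> = (\<integral>x. D x * indicator A x \<partial>unit_leb)"
      unfolding MD using D A by (subst integral_density) auto
    finally show ?thesis .
  qed
  have intD: "integrable unit_leb D"
  proof -
    have "integrable M (\<lambda>x. 1 :: real)" by simp
    then show ?thesis unfolding MD using D by (subst (asm) integrable_density) auto
  qed
  have D1: "(\<integral>x. D x \<partial>unit_leb) = 1"
  proof -
    have "1 = measure M {0..<1}" using M.prob_space by (simp add: spM)
    also have "\<dots> = (\<integral>x. D x * indicator {0..<1} x \<partial>unit_leb)"
      by (rule meas) (simp add: sets_unit_leb_iff)
    also have "\<dots> = (\<integral>x. D x \<partial>unit_leb)"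
      by (intro Bochner_Integration.integral_cong) auto
    finally show ?thesis by simp
  qed
  show ?thesis
  proof (rule measure_eqI)
    fix A assume "A \<in> sets M"
    then have A: "A \<in> sets unit_leb" by (simp add: sM)
    have "measure M (vimage_iter \<gamma> k A) = measure M A" for k
    proof (induction k)
      case (Suc k)
      have "measure M (vimage_iter \<gamma> (Suc k) A) = measure (distr M M (T_map \<gamma>)) (vimage_iter \<gamma> k A)"
        using T vimage_iter_sets[OF A] by (simp add: measure_distr sM spM)
      then show ?case using Suc by (simp only: inv)
    qed simp
    then have "(\<lambda>k. measure M A) \<longlonglongrightarrow> 1 * measure (parry \<gamma>) A"
      using integral_mixing[OF g A intD] by (simp add: meas[OF vimage_iter_sets[OF A], symmetric] D1)
    then have "measure M A = measure (parry \<gamma>) A"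
      by (simp add: LIMSEQ_const_iff)
    then show "emeasure M A = emeasure (parry \<gamma>) A"
      by (simp add: M.emeasure_eq_measure P.emeasure_eq_measure)
  qed (simp add: sM)
qed

section \<open>The invariant measures of the alternate base transformation\<close>

text \<open>The integer part removed by the inner map becomes an integer again after multiplication
  by \<open>n\<close>, and the outer fractional part ignores it.\<close>

lemma T_map_comp_nat: "T_map (real n) \<circ> T_map \<beta> = T_map (real n * \<beta>)"
proof
  fix x :: real
  have "real n * frac (\<beta> * x) = real n * \<beta> * x + of_int (- (int n * \<lfloor>\<beta> * x\<rfloor>))"
    by (simp add: frac_def algebra_simps)
  then show "(T_map (real n) \<circ> T_map \<beta>) x = T_map (real n * \<beta>) x"
    unfolding o_def T_map_def by (simp only: frac_add_of_int_right)
qed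

lemma null_sets_T_map_vimage:
  assumes "\<gamma> > 0" and "A \<in> null_sets unit_leb"
  shows "T_map \<gamma> -` A \<inter> {0..<1} \<in> null_sets unit_leb"
proof -
  have A: "A \<in> sets unit_leb" using assms by auto
  have "{0..<frac \<gamma>} \<inter> A \<in> null_sets unit_leb"
    using assms by (intro null_set_Int1 sets_unit_leb_interval) (auto simp: frac_lt_1 less_imp_le)
  then have "measure unit_leb ({0..<1} \<inter> T_map \<gamma> -` A) = 0"
    using assms measure_T_map_vimage[OF assms(1) _ _ A, of 1] by (simp add: measure_def null_sets_def)
  then show ?thesis
    using T_map_vimage_sets[OF A, of \<gamma>] by (auto simp: null_sets_def U.emeasure_eq_measure Int_commute)
qed

text \<open>\<open>T_map t\<close> intertwines the two orders of composition, so it carries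
  invariant measures of one order to the other. Pushing on by \<open>T_map s\<close> applies the
  original composition and recovers \<open>N\<close>; this is what transfers uniqueness.\<close>

lemma acim_comp_swap:
  assumes st: "s > 0" "t > 0" and N: "acim (T_map s \<circ> T_map t) N"
  shows "acim (T_map t \<circ> T_map s) (distr N unit_leb (T_map t))"
    and "N = distr (distr N unit_leb (T_map t)) unit_leb (T_map s)"
proof -
  have sN [measurable_cong]: "sets N = sets unit_leb" and ac: "absolutely_continuous unit_leb N"
    and inv: "distr N N (T_map s \<circ> T_map t) = N" and pN: "prob_space N"
    using N by (auto simp: acim_def)
  interpret N: prob_space N by (rule pN)
  have spN: "space N = {0..<1}" using sets_eq_imp_space_eq[OF sN] by simp
  have mN: "measurable N K = measurable unit_leb K" "measurable K N = measurable K unit_leb" for K :: "real measure"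
    by (auto intro!: measurable_cong_sets sN)
  have T: "T_map \<gamma> \<in> measurable N unit_leb" for \<gamma> by (simp add: mN)
  have inv': "distr N unit_leb (T_map s \<circ> T_map t) = N"
    using inv by (simp cong: distr_cong add: distr_cong[OF refl sN[symmetric] refl])
  let ?M = "distr N unit_leb (T_map t)"
  show eq: "N = distr ?M unit_leb (T_map s)"
    by (subst distr_distr[OF T_map_measurable T]) (simp only: inv')
  have comp: "T_map t \<circ> T_map s \<in> measurable unit_leb unit_leb"
    by (rule measurable_comp[OF T_map_measurable T_map_measurable])
  have "distr ?M ?M (T_map t \<circ> T_map s) = distr ?M unit_leb (T_map t \<circ> T_map s)"
    by (rule distr_cong) auto
  also have "\<dots> = distr (distr ?M unit_leb (T_map s)) unit_leb (T_map t)"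
    by (subst distr_distr[OF T_map_measurable]) (simp_all only: measurable_distr_eq1 T_map_measurable)
  also have "\<dots> = ?M" by (simp only: eq[symmetric])
  finally have inv2: "distr ?M ?M (T_map t \<circ> T_map s) = ?M" .
  have "absolutely_continuous unit_leb ?M"
    unfolding absolutely_continuous_def
  proof
    fix A assume A: "A \<in> null_sets unit_leb"
    have "T_map t -` A \<inter> {0..<1} \<in> null_sets N"
      using null_sets_T_map_vimage[OF st(2) A] ac by (auto simp: absolutely_continuous_def)
    then show "A \<in> null_sets ?M"
      using A T by (auto simp: null_sets_def emeasure_distr spN)
  qed
  then show "acim (T_map t \<circ> T_map s) ?M"
    using inv2 comp N.prob_space_distr[OF T] 
    unfolding acim_def by (simp only: sets_distr measurable_distr_eq1 measurable_distr_eq2 simp_thms)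
qed

section \<open>Identification of the two composed measures\<close>

lemma mu_comp_nat_left:
  assumes "\<beta> > 1" "n \<ge> 2"
  shows "mu_comp (real n) \<beta> = parry (real n * \<beta>)"
proof -
  have "real n * \<beta> > 2" using mult_less_le_imp_less[of 1 \<beta> 2 "real n"] assms by (simp add: mult.commute)
  then show ?thesis
    unfolding mu_comp_def T_map_comp_nat by (intro the_equality acim_parry acim_unique) auto
qed

text \<open>Uniqueness is borrowed from the opposite order: a competitor \<open>N\<close> pushed
  forward by \<open>T_map (real n)\<close> is invariant under
  \<open>T_map (real n * \<beta>)\<close>, hence Parry's measure, and pushing forward by
  \<open>T_map \<beta>\<close> returns \<open>N\<close>.\<close>

lemma mu_comp_nat_right:
  assumes b: "\<beta> > 1" and n: "n \<ge> 2"
  shows "mu_comp \<beta> (real n) = distr (parry (real n * \<beta>)) unit_leb (T_map \<beta>)"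
proof -
  have g: "real n * \<beta> > 2" using mult_less_le_imp_less[of 1 \<beta> 2 "real n"] assms by (simp add: mult.commute)
  have "acim (T_map (real n) \<circ> T_map \<beta>) (parry (real n * \<beta>))"
    unfolding T_map_comp_nat using g by (intro acim_parry) simp
  then have "acim (T_map \<beta> \<circ> T_map (real n)) (distr (parry (real n * \<beta>)) unit_leb (T_map \<beta>))"
    using b n by (intro acim_comp_swap) auto
  then show ?thesis
    unfolding mu_comp_def
  proof (rule the_equality)
    fix N assume N: "acim (T_map \<beta> \<circ> T_map (real n)) N"
    show "N = distr (parry (real n * \<beta>)) unit_leb (T_map \<beta>)"
    proof -
      have "acim (T_map (real n * \<beta>)) (distr N unit_leb (T_map (real n)))"
        using acim_comp_swap(1)[OF _ _ N] b n unfolding T_map_comp_nat by simp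
      then have "distr N unit_leb (T_map (real n)) = parry (real n * \<beta>)"
        by (rule acim_unique[OF g])
      then show ?thesis using acim_comp_swap(2)[OF _ _ N] b n by simp
    qed
  qed
qed

text \<open>\<open>measure_of\<close> takes the prescribed values only if they form a measure, and
  is 0 otherwise. Countable additivity is checked on the two sections of each set.\<close>

lemma emeasure_mu_alt:
  assumes s: "sets (mu_comp (real n) \<beta>) = sets unit_leb" "sets (mu_comp \<beta> (real n)) = sets unit_leb"
    and S: "S \<in> sets (count_space {0,1} \<Otimes>\<^sub>M unit_leb)"
  shows "emeasure (mu_alt \<beta> n) S = (1/2) * emeasure (mu_comp (real n) \<beta>) {x. (0, x) \<in> S}
        + (1/2) * emeasure (mu_comp \<beta> (real n)) {x. (1, x) \<in> S}"
proof -
  let ?P = "count_space {0::nat,1} \<Otimes>\<^sub>M unit_leb"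
  let ?f = "\<lambda>S. (1/2) * emeasure (mu_comp (real n) \<beta>) {x. (0, x) \<in> S}
        + (1/2) * emeasure (mu_comp \<beta> (real n)) {x. (1, x) \<in> S}"
  have sp: "space ?P = {0,1} \<times> {0..<1}" by (simp add: space_pair_measure)
  have sa: "sets (mu_alt \<beta> n) = sets ?P"
    unfolding mu_alt_def sp[symmetric] by (rule sets.sets_measure_of_eq)
  have sec: "{x. (i, x) \<in> S} \<in> sets unit_leb" if "S \<in> sets ?P" for S i
    using sets_Pair1[OF that, of i] by (simp add: vimage_def)
  show ?thesis
  proof (rule emeasure_measure_of[OF mu_alt_def])
    show "sets ?P \<subseteq> Pow ({0,1} \<times> {0..<1})" unfolding sp[symmetric] by (rule sets.space_closed)
    show "S \<in> sets (mu_alt \<beta> n)" using S by (simp only: sa)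
    show "positive (sets (mu_alt \<beta> n)) ?f" by (simp add: positive_def)
    show "countably_additive (sets (mu_alt \<beta> n)) ?f"
      unfolding sa
    proof (rule countably_additiveI)
      fix A :: "nat \<Rightarrow> (nat \<times> real) set"
      assume A: "range A \<subseteq> sets ?P" "disjoint_family A"
      have *: "(\<Sum>k. emeasure M {x. (i, x) \<in> A k}) = emeasure M {x. (i, x) \<in> (\<Union>k. A k)}"
        if M: "sets M = sets unit_leb" for i M
      proof -
        have "(\<Sum>k. emeasure M {x. (i, x) \<in> A k}) = emeasure M (\<Union>k. {x. (i, x) \<in> A k})"
        proof (rule suminf_emeasure)
          show "range (\<lambda>k. {x. (i, x) \<in> A k}) \<subseteq> sets M" unfolding M using A(1) by (blast intro: sec)
          show "disjoint_family (\<lambda>k. {x. (i, x) \<in> A k})"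
            using A(2) unfolding disjoint_family_on_def by blast
        qed
        moreover have "(\<Union>k. {x. (i, x) \<in> A k}) = {x. (i, x) \<in> (\<Union>k. A k)}" by auto
        ultimately show ?thesis by (simp only:)
      qed
      show "(\<Sum>k. ?f (A k)) = ?f (\<Union>k. A k)"
        unfolding suminf_add[OF summableI summableI, symmetric] ennreal_suminf_cmult *[OF s(1)] *[OF s(2)] ..
    qed
  qed
qed

text \<open>The sets {0} \<times> A and {1} \<times> A isolate the two components.\<close>

lemma mu_alt_eq_imp_mu_comp_eq:
  assumes s: "sets (mu_comp (real n) \<beta>) = sets unit_leb" "sets (mu_comp \<beta> (real n)) = sets unit_leb"
    "sets (mu_comp (real m) \<beta>') = sets unit_leb" "sets (mu_comp \<beta>' (real m)) = sets unit_leb"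
    and eq: "mu_alt \<beta> n = mu_alt \<beta>' m"
  shows "mu_comp (real n) \<beta> = mu_comp (real m) \<beta>'" "mu_comp \<beta> (real n) = mu_comp \<beta>' (real m)"
proof -
  have half: "(1/2) * x = (1/2) * y \<Longrightarrow> x = (y :: ennreal)" for x y
    by (subst (asm) ennreal_mult_cancel_left) (auto simp: ennreal_divide_eq_top_iff)
  show "mu_comp (real n) \<beta> = mu_comp (real m) \<beta>'"
  proof (rule measure_eqI)
    fix A assume "A \<in> sets (mu_comp (real n) \<beta>)"
    then have "{0} \<times> A \<in> sets (count_space {0::nat,1} \<Otimes>\<^sub>M unit_leb)" by (auto simp: s)
    from emeasure_mu_alt[OF s(1,2) this] emeasure_mu_alt[OF s(3,4) this]
    have "(1/2) * emeasure (mu_comp (real n) \<beta>) A = (1/2) * emeasure (mu_comp (real m) \<beta>') A"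
      unfolding eq by simp
    then show "emeasure (mu_comp (real n) \<beta>) A = emeasure (mu_comp (real m) \<beta>') A" by (rule half)
  qed (simp add: s)
  show "mu_comp \<beta> (real n) = mu_comp \<beta>' (real m)"
  proof (rule measure_eqI)
    fix A assume "A \<in> sets (mu_comp \<beta> (real n))"
    then have "{1} \<times> A \<in> sets (count_space {0::nat,1} \<Otimes>\<^sub>M unit_leb)" by (auto simp: s)
    from emeasure_mu_alt[OF s(1,2) this] emeasure_mu_alt[OF s(3,4) this]
    have "(1/2) * emeasure (mu_comp \<beta> (real n)) A = (1/2) * emeasure (mu_comp \<beta>' (real m)) A"
      unfolding eq by simp
    then show "emeasure (mu_comp \<beta> (real n)) A = emeasure (mu_comp \<beta>' (real m)) A" by (rule half)
  qed (simp add: s)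
qed

section \<open>One-sided densities\<close>

definition orb_image :: "real \<Rightarrow> real \<Rightarrow> nat \<Rightarrow> real" where
  "orb_image \<beta> \<gamma> k = frac (\<beta> * orb \<gamma> k)"

lemma orb_image_nonneg: "0 \<le> orb_image \<beta> \<gamma> k" and orb_image_less_1: "orb_image \<beta> \<gamma> k < 1"
  by (auto simp: orb_image_def frac_lt_1)

lemma measure_unit_leb_interval_Int:
  "0 \<le> b \<Longrightarrow> 0 \<le> a \<Longrightarrow> a \<le> 1 \<Longrightarrow> measure unit_leb ({0..<b} \<inter> {0..<a}) = min a b"
  using measure_unit_leb_interval[of "min a b"] by (simp add: Int_atLeastLessThan min.commute)

section \<open>Distribution functions of the two measures\<close>

lemma parry_cdf_sums:
  assumes g: "\<gamma> > 1" and a: "0 \<le> a" "a \<le> 1"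
  shows "(\<lambda>k. min a (orb \<gamma> k) / \<gamma> ^ k) sums (parry_const \<gamma> * measure (parry \<gamma>) {0..<a})"
proof -
  have "summable (\<lambda>k. min a (orb \<gamma> k) / \<gamma> ^ k)"
    by (rule summable_geometric_bounded[where B = 1]) (use g a in \<open>auto simp: orb_nonneg\<close>)
  moreover have "parry_const \<gamma> * measure (parry \<gamma>) {0..<a} = (\<Sum>k. min a (orb \<gamma> k) / \<gamma> ^ k)"
    using parry_const_pos[OF g] a
    by (subst measure_parry) (auto simp: g sets_unit_leb_interval measure_unit_leb_interval_Int orb_nonneg
        simp del: Int_atLeastLessThan)
  ultimately show ?thesis by (simp add: summable_sums)
qed

text \<open>The floors contribute a constant to the density, so a multiple of \<open>a\<close> here.
  The later arguments use differences of densities, in which it cancels.\<close>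

lemma parry_image_cdf_sums:
  assumes g: "\<gamma> > 1" and b: "\<beta> > 0" and a: "0 \<le> a" "a \<le> 1"
  shows "(\<lambda>k. (of_int \<lfloor>\<beta> * orb \<gamma> k\<rfloor> * a + min a (orb_image \<beta> \<gamma> k)) / \<gamma> ^ k) sums
    (\<beta> * parry_const \<gamma> * measure (distr (parry \<gamma>) unit_leb (T_map \<beta>)) {0..<a})"
proof -
  let ?f = "\<lambda>k. of_int \<lfloor>\<beta> * orb \<gamma> k\<rfloor> * a + min a (orb_image \<beta> \<gamma> k)"
  have "summable (\<lambda>k. ?f k / \<gamma> ^ k)"
  proof (rule summable_geometric_bounded[OF g])
    fix k
    have 1: "of_int \<lfloor>\<beta> * orb \<gamma> k\<rfloor> \<le> \<beta>"
      using b mult_left_mono[OF orb_le_1[of \<gamma> k], of \<beta>]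
      by (intro order_trans[OF of_int_floor_le]) simp
    have 2: "0 \<le> real_of_int \<lfloor>\<beta> * orb \<gamma> k\<rfloor>" using b by (simp add: orb_nonneg)
    have "of_int \<lfloor>\<beta> * orb \<gamma> k\<rfloor> * a \<le> \<beta> * 1" using 1 2 b a by (intro mult_mono) auto
    then show "\<bar>?f k\<bar> \<le> \<beta> + 1"
      using 2 a orb_image_nonneg[of \<beta> \<gamma> k] by (subst abs_of_nonneg) (auto intro!: add_mono add_nonneg_nonneg)
  qed
  moreover have "\<beta> * parry_const \<gamma> * measure (distr (parry \<gamma>) unit_leb (T_map \<beta>)) {0..<a} = (\<Sum>k. ?f k / \<gamma> ^ k)"
  proof -
    have "T_map \<beta> \<in> measurable (parry \<gamma>) unit_leb" by measurable
    then have "measure (distr (parry \<gamma>) unit_leb (T_map \<beta>)) {0..<a} = measure (parry \<gamma>) (T_map \<beta> -` {0..<a} \<inter> {0..<1})"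
      using a by (subst measure_distr) (auto simp: sets_unit_leb_interval)
    also have "\<dots> = (\<Sum>k. ?f k / \<gamma> ^ k) / (\<beta> * parry_const \<gamma>)"
      using a by (subst measure_parry_vimage[OF _ g b])
        (auto simp: sets_unit_leb_interval measure_unit_leb_interval measure_unit_leb_interval_Int orb_image_def
          simp del: Int_atLeastLessThan)
    finally show ?thesis using b parry_const_pos[OF g] by simp
  qed
  ultimately show ?thesis by (simp add: summable_sums)
qed

text \<open>Dominated exchange of limit and sum with majorant 1 / \<gamma> ^ k, for difference
  quotients that become constant for each fixed \<open>k\<close>.\<close>

lemma tendsto_suminf_eventually_const:
  fixes \<phi> :: "nat \<Rightarrow> nat \<Rightarrow> real"
  assumes g: "\<gamma> > 1" and b: "\<And>k j. \<bar>\<phi> k j\<bar> \<le> 1"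
    and ev: "\<And>k. \<forall>\<^sub>F j in sequentially. \<phi> k j = l k"
  shows "(\<lambda>j. \<Sum>k. \<phi> k j / \<gamma> ^ k) \<longlonglongrightarrow> (\<Sum>k. l k / \<gamma> ^ k)"
proof (rule tannerys_theorem[THEN conjunct2, THEN conjunct2])
  show "summable (\<lambda>k. 1 / \<gamma> ^ k)"
    by (rule summable_geometric_bounded[OF g, where B = 1]) simp
  show "\<forall>\<^sub>F (k, j) in at_top \<times>\<^sub>F sequentially. norm (\<phi> k j / \<gamma> ^ k) \<le> 1 / \<gamma> ^ k"
    using g b by (intro always_eventually) (auto simp: divide_right_mono)
  show "(\<lambda>j. \<phi> k j / \<gamma> ^ k) \<longlonglongrightarrow> l k / \<gamma> ^ k" for k
    by (rule tendsto_eventually, rule eventually_mono[OF ev[of k]]) simp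
qed simp

text \<open>A null sequence; the summand 2 keeps it below 1 from index 0 on, so
  \<open>step j\<close> and \<open>1 - step j\<close> always lie in (0,1).\<close>

definition step :: "nat \<Rightarrow> real" where
  "step j = 1 / (real j + 2)"

lemma step_pos: "0 < step j" and step_less_1: "step j < 1"
  by (auto simp: step_def)

lemma eventually_step_less: "0 < e \<Longrightarrow> \<forall>\<^sub>F j in sequentially. step j < e"
proof -
  assume "0 < e"
  moreover have "step \<longlonglongrightarrow> 0"
    using LIMSEQ_ignore_initial_segment[OF lim_1_over_n[where ?'a = real], of 2] by (simp add: step_def[abs_def] add.commute)
  ultimately show ?thesis by (auto dest: order_tendstoD)
qed

text \<open>The right derivative at 0 of a \<mapsto> min a t: the quotient equals 1 as soon as
  \<open>step j\<close> is below a positive t.\<close>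

lemma min_step_quotient:
  assumes "0 \<le> t"
  shows "0 \<le> min (step j) t / step j" "min (step j) t / step j \<le> 1"
    "\<forall>\<^sub>F j in sequentially. min (step j) t / step j = of_bool (0 < t)"
proof -
  show "0 \<le> min (step j) t / step j" "min (step j) t / step j \<le> 1"
    using assms step_pos[of j] by auto
  show "\<forall>\<^sub>F j in sequentially. min (step j) t / step j = of_bool (0 < t)"
  proof (cases "t = 0")
    case False
    then show ?thesis using assms step_pos
      by (intro eventually_mono[OF eventually_step_less[of t]]) (auto simp: less_imp_neq[symmetric])
  qed (use step_pos in \<open>simp add: min_absorb2 less_imp_le\<close>)
qed

text \<open>The left derivative at 1 of a \<mapsto> min a t: for t < 1 both minima equal t as soon
  as \<open>step j\<close> is below 1 - t.\<close>

lemma min_step_quotient_1: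
  assumes "t \<le> 1"
  shows "0 \<le> (min 1 t - min (1 - step j) t) / step j" "(min 1 t - min (1 - step j) t) / step j \<le> 1"
    "\<forall>\<^sub>F j in sequentially. (min 1 t - min (1 - step j) t) / step j = of_bool (t = 1)"
proof -
  show "0 \<le> (min 1 t - min (1 - step j) t) / step j" "(min 1 t - min (1 - step j) t) / step j \<le> 1"
    using assms step_pos[of j] by (auto simp: min_def)
  show "\<forall>\<^sub>F j in sequentially. (min 1 t - min (1 - step j) t) / step j = of_bool (t = 1)"
  proof (cases "t = 1")
    case False
    then show ?thesis using assms
      by (intro eventually_mono[OF eventually_step_less[of "1 - t"]]) (auto simp: min_def)
  qed (use step_pos in \<open>simp add: less_imp_le less_imp_neq[symmetric]\<close>)
qed

text \<open>The sum S of the overview: the value at 0 of Parry's density times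
  \<open>parry_const \<gamma>\<close>. The next definition is W.\<close>

definition orb_weight :: "real \<Rightarrow> real" where
  "orb_weight \<gamma> = (\<Sum>k. of_bool (0 < orb \<gamma> k) / \<gamma> ^ k)"

definition orb_image_weight :: "real \<Rightarrow> real \<Rightarrow> real" where
  "orb_image_weight \<beta> \<gamma> = (\<Sum>k. of_bool (0 < orb_image \<beta> \<gamma> k) / \<gamma> ^ k)"

section \<open>Boundary values of the densities\<close>

lemma parry_density_left:
  assumes g: "\<gamma> > 1"
  shows "(\<lambda>j. measure (parry \<gamma>) {0..<step j} / step j) \<longlonglongrightarrow> orb_weight \<gamma> / parry_const \<gamma>"
proof -
  let ?\<phi> = "\<lambda>k j. min (step j) (orb \<gamma> k) / step j"
  have "(\<lambda>k. ?\<phi> k j / \<gamma> ^ k) sums (parry_const \<gamma> * (measure (parry \<gamma>) {0..<step j} / step j))" for j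
    using sums_divide[OF parry_cdf_sums[OF g, of "step j"], of "step j"] step_pos[of j] step_less_1[of j]
    by (simp add: less_imp_le mult.commute)
  note eq = sums_unique[OF this, symmetric]
  have lim: "(\<lambda>j. \<Sum>k. ?\<phi> k j / \<gamma> ^ k) \<longlonglongrightarrow> orb_weight \<gamma>"
    unfolding orb_weight_def
  proof (rule tendsto_suminf_eventually_const[OF g _ min_step_quotient(3)[OF orb_nonneg]])
    show "\<bar>?\<phi> k j\<bar> \<le> 1" for k j
      using min_step_quotient(1,2)[OF orb_nonneg[of \<gamma> k], of j] by linarith
  qed
  show ?thesis
    using tendsto_divide[OF lim[unfolded eq] tendsto_const[of "parry_const \<gamma>"]] parry_const_pos[OF g] by simp
qed

lemma parry_density_right:
  assumes g: "\<gamma> > 1"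
  shows "(\<lambda>j. (measure (parry \<gamma>) {0..<1} - measure (parry \<gamma>) {0..<1 - step j}) / step j)
    \<longlonglongrightarrow> 1 / parry_const \<gamma>"
proof -
  let ?\<phi> = "\<lambda>k j. (min 1 (orb \<gamma> k) - min (1 - step j) (orb \<gamma> k)) / step j"
  let ?F = "\<lambda>a. measure (parry \<gamma>) {0..<a}"
  have "(\<lambda>k. ?\<phi> k j / \<gamma> ^ k) sums (parry_const \<gamma> * ((?F 1 - ?F (1 - step j)) / step j))" for j
    using sums_divide[OF sums_diff[OF parry_cdf_sums[OF g, of 1] parry_cdf_sums[OF g, of "1 - step j"]], of "step j"]
      step_pos[of j] step_less_1[of j]
    by (simp add: less_imp_le mult.commute diff_divide_distrib right_diff_distrib)
  note eq = sums_unique[OF this, symmetric]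
  have lim: "(\<lambda>j. \<Sum>k. ?\<phi> k j / \<gamma> ^ k) \<longlonglongrightarrow> (\<Sum>k. of_bool (orb \<gamma> k = 1) / \<gamma> ^ k)"
  proof (rule tendsto_suminf_eventually_const[OF g _ min_step_quotient_1(3)[OF orb_le_1]])
    show "\<bar>?\<phi> k j\<bar> \<le> 1" for k j
      using min_step_quotient_1(1,2)[OF orb_le_1[of \<gamma> k], of j] by linarith
  qed
  \<comment> \<open>Only the interval of index 0 reaches up to 1, since
    \<open>orb \<gamma> (Suc k)\<close> is always below 1.\<close>
  also have "(\<Sum>k. of_bool (orb \<gamma> k = 1) / \<gamma> ^ k) = 1"
  proof -
    have "(\<Sum>k. of_bool (orb \<gamma> k = 1) / \<gamma> ^ k) = (\<Sum>k\<in>{0}. of_bool (orb \<gamma> k = 1) / \<gamma> ^ k)"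
    proof (rule suminf_finite)
      fix k assume "k \<notin> {0::nat}"
      then show "of_bool (orb \<gamma> k = 1) / \<gamma> ^ k = 0" using orb_Suc_less_1[of \<gamma> "k - 1"] by auto
    qed simp
    then show ?thesis by simp
  qed
  finally have lim1: "(\<lambda>j. \<Sum>k. ?\<phi> k j / \<gamma> ^ k) \<longlonglongrightarrow> 1" .
  show ?thesis
    using tendsto_divide[OF lim1[unfolded eq] tendsto_const[of "parry_const \<gamma>"]] parry_const_pos[OF g] by simp
qed

text \<open>Between 0 and 1 the density drops once at every positive
  \<open>orb_image \<beta> \<gamma> k\<close>, all of which are below 1. \<open>F\<close> is
  abstract so that both bases can be applied to one function.\<close>

lemma parry_image_density_drop:
  assumes g: "\<gamma> > 1" and b: "\<beta> > 0"
    and F: "\<And>a. F a = measure (distr (parry \<gamma>) unit_leb (T_map \<beta>)) {0..<a}"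
  shows "(\<lambda>j. (F (step j) - (F 1 - F (1 - step j))) / step j)
    \<longlonglongrightarrow> orb_image_weight \<beta> \<gamma> / (\<beta> * parry_const \<gamma>)"
proof -
  let ?s = "orb_image \<beta> \<gamma>" and ?c = "\<beta> * parry_const \<gamma>"
  let ?\<phi> = "\<lambda>k j. min (step j) (?s k) / step j - (min 1 (?s k) - min (1 - step j) (?s k)) / step j"
  have c: "?c > 0" using b parry_const_pos[OF g] by simp
  have S: "(\<lambda>k. (of_int \<lfloor>\<beta> * orb \<gamma> k\<rfloor> * a + min a (?s k)) / \<gamma> ^ k) sums (?c * F a)" if "0 \<le> a" "a \<le> 1" for a
    unfolding F by (rule parry_image_cdf_sums[OF g b that])
  have "(\<lambda>k. ?\<phi> k j / \<gamma> ^ k) sums (?c * ((F (step j) - (F 1 - F (1 - step j))) / step j))" for j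
  proof -
    have j: "0 < step j" "step j < 1" by (auto simp: step_pos step_less_1)
    let ?t = "\<lambda>k a. (of_int \<lfloor>\<beta> * orb \<gamma> k\<rfloor> * a + min a (?s k)) / \<gamma> ^ k"
    have "(\<lambda>k. (?t k (step j) - (?t k 1 - ?t k (1 - step j))) / step j) sums
        ((?c * F (step j) - (?c * F 1 - ?c * F (1 - step j))) / step j)"
      using j by (intro sums_divide sums_diff S) auto
    moreover have "(?t k (step j) - (?t k 1 - ?t k (1 - step j))) / step j = ?\<phi> k j / \<gamma> ^ k" for k
      using j g by (simp add: divide_simps) (simp add: algebra_simps)
    moreover have "(?c * F (step j) - (?c * F 1 - ?c * F (1 - step j))) / step j
       = ?c * ((F (step j) - (F 1 - F (1 - step j))) / step j)"
      by (simp add: algebra_simps)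
    ultimately show ?thesis by simp
  qed
  note eq = sums_unique[OF this, symmetric]
  have lim: "(\<lambda>j. \<Sum>k. ?\<phi> k j / \<gamma> ^ k) \<longlonglongrightarrow> orb_image_weight \<beta> \<gamma>"
    unfolding orb_image_weight_def
  proof (rule tendsto_suminf_eventually_const[OF g])
    fix k
    show "\<bar>?\<phi> k j\<bar> \<le> 1" for j
      using min_step_quotient(1,2)[OF orb_image_nonneg[of \<beta> \<gamma> k], of j]
        min_step_quotient_1(1,2)[OF less_imp_le[OF orb_image_less_1[of \<beta> \<gamma> k]], of j] by linarith
    show "\<forall>\<^sub>F j in sequentially. ?\<phi> k j = of_bool (0 < ?s k)"
      using min_step_quotient(3)[OF orb_image_nonneg[of \<beta> \<gamma> k]]
        min_step_quotient_1(3)[OF less_imp_le[OF orb_image_less_1[of \<beta> \<gamma> k]]]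
    proof eventually_elim
      case (elim j)
      then show ?case using orb_image_less_1[of \<beta> \<gamma> k] by simp
    qed
  qed
  show ?thesis
    using tendsto_divide[OF lim[unfolded eq] tendsto_const[of ?c]] b parry_const_pos[OF g] by simp
qed

section \<open>Comparison of two bases\<close>

lemma orb_zero_propagates:
  assumes "orb \<gamma> k = 0" "k \<le> j"
  shows "orb \<gamma> j = 0"
  using assms(2,1) by (induction rule: dec_induct) (auto simp: orb_Suc)

lemma orb_image_zero_if: "orb \<gamma> k = 0 \<Longrightarrow> orb_image \<beta> \<gamma> k = 0"
  by (simp add: orb_image_def)

text \<open>The next orbit point is the fractional part of n times \<beta>
  \<open>orb (real n * \<beta>) k\<close>, which is an integer here.\<close>

lemma orb_Suc_zero_if_image:
  assumes "orb_image \<beta> (real n * \<beta>) k = 0"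
  shows "orb (real n * \<beta>) (Suc k) = 0"
proof -
  have "\<beta> * orb (real n * \<beta>) k \<in> \<int>" using assms by (simp add: orb_image_def)
  then have "real n * (\<beta> * orb (real n * \<beta>) k) \<in> \<int>" by (rule Ints_mult[OF Ints_of_nat])
  then show ?thesis by (simp add: orb_Suc mult.assoc)
qed

lemma summable_of_bool: "\<gamma> > 1 \<Longrightarrow> summable (\<lambda>k. of_bool (P k) / \<gamma> ^ k :: real)"
  by (rule summable_geometric_bounded[where B = 1]) auto

lemma orb_image_weight_le:
  assumes "\<gamma> > 1"
  shows "orb_image_weight \<beta> \<gamma> \<le> orb_weight \<gamma>"
  unfolding orb_image_weight_def orb_weight_def
proof (rule suminf_le)
  fix k
  show "of_bool (0 < orb_image \<beta> \<gamma> k) / \<gamma> ^ k \<le> of_bool (0 < orb \<gamma> k) / \<gamma> ^ k"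
    using orb_image_zero_if[of \<gamma> k \<beta>] orb_nonneg[of \<gamma> k] assms by (auto simp: less_le)
qed (use assms summable_of_bool in auto)

lemma orb_image_weight_pos:
  assumes "\<gamma> > 1" "\<beta> \<notin> \<rat>"
  shows "orb_image_weight \<beta> \<gamma> > 0"
proof -
  have "\<beta> \<notin> \<int>" using assms Ints_subset_Rats by auto
  then have "0 < orb_image \<beta> \<gamma> 0" by (simp add: orb_image_def)
  then show ?thesis
    unfolding orb_image_weight_def using assms
    by (intro suminf_pos2[OF summable_of_bool, of _ _ 0]) auto
qed

text \<open>A strict inequality between the two weights forces the orbit of 1 to hit 0 in finitely many
  steps, with the zero already reached halfway through the last step.\<close>

lemma orb_image_weight_less:
  assumes g: "\<gamma> = real n * \<beta>" "\<gamma> > 1" and b: "\<beta> \<notin> \<rat>"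
    and less: "orb_image_weight \<beta> \<gamma> < orb_weight \<gamma>"
  obtains k where "0 < k" "\<And>j. k \<le> j \<Longrightarrow> orb_image \<beta> \<gamma> j = 0"
    "orb_image_weight \<beta> \<gamma> = (\<Sum>j<k. 1 / \<gamma> ^ j)" "orb_weight \<gamma> = (\<Sum>j<k. 1 / \<gamma> ^ j) + 1 / \<gamma> ^ k"
proof -
  let ?s = "orb_image \<beta> \<gamma>" and ?t = "orb \<gamma>"
  have "\<exists>k. (0 < ?t k) \<noteq> (0 < ?s k)"
  proof (rule ccontr)
    assume "\<not> (\<exists>k. (0 < ?t k) \<noteq> (0 < ?s k))"
    then have "orb_image_weight \<beta> \<gamma> = orb_weight \<gamma>"
      unfolding orb_image_weight_def orb_weight_def by auto
    then show False using less by simp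
  qed
  then obtain k where k: "0 < ?t k" "?s k = 0"
    using orb_image_zero_if orb_nonneg orb_image_nonneg by (metis less_eq_real_def less_irrefl)
  have \<beta>: "\<beta> \<notin> \<int>" using b Ints_subset_Rats by auto
  \<comment> \<open>The image point of index 0 is \<open>frac \<beta>\<close>, which is nonzero for
    irrational \<beta>.\<close>
  then have "k \<noteq> 0" using k by (auto simp: orb_image_def intro: ccontr)
  then have k0: "0 < k" by simp
  \<comment> \<open>Zeros spread in the order t j, s j, t (j + 1). So everything after s k vanishes,
    while t k > 0 keeps all earlier entries positive.\<close>
  have step: "?t (Suc j) = 0" if "?s j = 0" for j
    using that orb_Suc_zero_if_image unfolding g(1) by blast
  have tz: "?t j = 0" if "k < j" for j
    using orb_zero_propagates[OF step[OF k(2)], of j] that by simp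
  have sz: "?s j = 0" if "k \<le> j" for j
    using that k(2) tz[of j] orb_image_zero_if[of \<gamma> j \<beta>] by (cases "j = k") auto
  have sp: "0 < ?s j" if "j < k" for j
  proof (rule ccontr)
    assume "\<not> 0 < ?s j"
    then have "?s j = 0" using orb_image_nonneg[of \<beta> \<gamma> j] by simp
    from orb_zero_propagates[OF step[OF this], of k] show False using that k(1) by simp
  qed
  have tp: "0 < ?t j" if "j \<le> k" for j
    using that k(1) sp[of j] orb_image_zero_if[of \<gamma> j \<beta>] orb_nonneg[of \<gamma> j]
    by (cases "j = k") (auto simp: less_le)
  have "orb_image_weight \<beta> \<gamma> = (\<Sum>j<k. of_bool (0 < ?s j) / \<gamma> ^ j)"
    unfolding orb_image_weight_def by (rule suminf_finite) (auto simp: sz)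
  also have "\<dots> = (\<Sum>j<k. 1 / \<gamma> ^ j)" by (rule sum.cong) (auto simp: sp)
  finally have 1: "orb_image_weight \<beta> \<gamma> = (\<Sum>j<k. 1 / \<gamma> ^ j)" .
  have "orb_weight \<gamma> = (\<Sum>j<Suc k. of_bool (0 < ?t j) / \<gamma> ^ j)"
    unfolding orb_weight_def by (rule suminf_finite) (auto simp: tz)
  also have "\<dots> = (\<Sum>j<Suc k. 1 / \<gamma> ^ j)" by (rule sum.cong) (auto simp: tp)
  finally have 2: "orb_weight \<gamma> = (\<Sum>j<k. 1 / \<gamma> ^ j) + 1 / \<gamma> ^ k" by simp
  show ?thesis by (rule that[OF k0 sz 1 2])
qed

text \<open>The negated second difference of a \<mapsto> min a s at y. As a function of s it is a
  triangle of height \<delta> centred at y and supported on [y - \<delta>, y + \<delta>].\<close>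

definition tent :: "real \<Rightarrow> real \<Rightarrow> real \<Rightarrow> real" where
  "tent \<delta> y s = 2 * min y s - min (y - \<delta>) s - min (y + \<delta>) s"

lemma tent_nonneg: "0 \<le> \<delta> \<Longrightarrow> 0 \<le> tent \<delta> y s" and tent_le: "0 \<le> \<delta> \<Longrightarrow> tent \<delta> y s \<le> \<delta>"
  and tent_eq_0: "\<delta> \<le> \<bar>y - s\<bar> \<Longrightarrow> 0 \<le> \<delta> \<Longrightarrow> tent \<delta> y s = 0" and tent_peak: "0 \<le> \<delta> \<Longrightarrow> tent \<delta> y y = \<delta>"
  by (auto simp: tent_def min_def)

text \<open>The second difference annihilates the terms linear in \<open>a\<close> and leaves a
  weighted count of the jumps near \<open>y\<close>.\<close>

lemma tent_sums:
  assumes g: "\<gamma> > 1" and b: "\<beta> > 0"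
    and F: "\<And>a. F a = measure (distr (parry \<gamma>) unit_leb (T_map \<beta>)) {0..<a}"
    and \<delta>: "0 \<le> \<delta>" "\<delta> \<le> y" "y + \<delta> \<le> 1"
  shows "(\<lambda>k. tent \<delta> y (orb_image \<beta> \<gamma> k) / \<gamma> ^ k) sums
    (\<beta> * parry_const \<gamma> * (2 * F y - F (y - \<delta>) - F (y + \<delta>)))"
proof -
  let ?c = "\<beta> * parry_const \<gamma>"
  let ?t = "\<lambda>k a. (of_int \<lfloor>\<beta> * orb \<gamma> k\<rfloor> * a + min a (orb_image \<beta> \<gamma> k)) / \<gamma> ^ k"
  have "(\<lambda>k. 2 * ?t k y - ?t k (y - \<delta>) - ?t k (y + \<delta>)) sums (2 * (?c * F y) - ?c * F (y - \<delta>) - ?c * F (y + \<delta>))"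
    unfolding F using \<delta> by (intro sums_diff sums_mult parry_image_cdf_sums g b) auto
  moreover have "2 * ?t k y - ?t k (y - \<delta>) - ?t k (y + \<delta>) = tent \<delta> y (orb_image \<beta> \<gamma> k) / \<gamma> ^ k" for k
    using g by (simp add: tent_def divide_simps) (simp add: algebra_simps)
  ultimately show ?thesis by (simp add: algebra_simps)
qed

text \<open>The first inequality forces W > 1. Multiplied by W and combined with the second it gives
  W \<le> (W + a) (W - 1), that is a \<le> W (W - 2 + a), but W \<le> 2 (1 - a) makes the right side
  negative.\<close>

lemma weight_arith:
  fixes b b' W a :: real
  assumes b: "0 < b" "0 < b'" and W: "0 < W" "W \<le> 2 * (1 - a)" "0 < a"
    and 1: "b \<le> b' * (W - 1)" and 2: "b' * W \<le> b * (W + a)"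
  shows False
proof -
  have "W > 1"
  proof (rule ccontr)
    assume "\<not> W > 1"
    then have "b' * (W - 1) \<le> 0" using b by (simp add: mult_nonneg_nonpos)
    then show False using 1 b by simp
  qed
  have "b * W \<le> (b' * (W - 1)) * W" using 1 W by (intro mult_right_mono) auto
  also have "\<dots> = (b' * W) * (W - 1)" by simp
  also have "\<dots> \<le> (b * (W + a)) * (W - 1)" using 2 \<open>W > 1\<close> by (intro mult_right_mono) auto
  finally have "b * W \<le> b * ((W + a) * (W - 1))" by (simp add: mult.assoc)
  then have "W \<le> (W + a) * (W - 1)" using b by simp
  then have "0 \<le> W * (W - 2 + a) - a" by (simp add: algebra_simps)
  moreover have "W * (W - 2 + a) \<le> W * (- a)" using W by (intro mult_left_mono) auto
  moreover have "W * (- a) < 0" using W by simp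
  ultimately show False using W by linarith
qed

lemma no_common_measures_if_less:
  fixes n m :: nat
  assumes b: "1 < \<beta>" "\<beta> < \<beta>'" "\<beta> \<notin> \<rat>" "\<beta>' \<notin> \<rat>" and n: "2 \<le> n" "2 \<le> m"
    and eq1: "parry (real n * \<beta>) = parry (real m * \<beta>')"
    and eq2: "distr (parry (real n * \<beta>)) unit_leb (T_map \<beta>) = distr (parry (real m * \<beta>')) unit_leb (T_map \<beta>')"
  shows False
proof -
  define \<gamma> \<gamma>' where "\<gamma> = real n * \<beta>" and "\<gamma>' = real m * \<beta>'"
  have g2: "\<gamma> > 2" "\<gamma>' > 2"
    using mult_less_le_imp_less[of 1 \<beta> 2 "real n"] mult_less_le_imp_less[of 1 \<beta>' 2 "real m"] b n
    by (auto simp: \<gamma>_def \<gamma>'_def mult.commute)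
  then have g: "\<gamma> > 1" "\<gamma>' > 1" by auto
  note C = parry_const_pos[OF g(1)] parry_const_pos[OF g(2)]
  define F where "F a = measure (distr (parry \<gamma>) unit_leb (T_map \<beta>)) {0..<a}" for a
  have F': "F a = measure (distr (parry \<gamma>') unit_leb (T_map \<beta>')) {0..<a}" for a
    unfolding F_def using eq2 by (simp add: \<gamma>_def \<gamma>'_def)
  have eq1': "parry \<gamma>' = parry \<gamma>" using eq1 by (simp add: \<gamma>_def \<gamma>'_def)
  have "1 / parry_const \<gamma> = 1 / parry_const \<gamma>'"
    using LIMSEQ_unique[OF parry_density_right[OF g(1)] parry_density_right[OF g(2), unfolded eq1']] .
  then have CC: "parry_const \<gamma>' = parry_const \<gamma>" by simp
  have "orb_weight \<gamma> / parry_const \<gamma> = orb_weight \<gamma>' / parry_const \<gamma>'"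
    using LIMSEQ_unique[OF parry_density_left[OF g(1)] parry_density_left[OF g(2), unfolded eq1']] .
  then have SS: "orb_weight \<gamma>' = orb_weight \<gamma>" using C CC by simp
  have b0: "\<beta> > 0" "\<beta>' > 0" using b by auto
  let ?W = "orb_image_weight \<beta> \<gamma>" and ?W' = "orb_image_weight \<beta>' \<gamma>'"
  have "?W / (\<beta> * parry_const \<gamma>) = ?W' / (\<beta>' * parry_const \<gamma>')"
    using LIMSEQ_unique[OF parry_image_density_drop[OF g(1) b0(1) F_def] parry_image_density_drop[OF g(2) b0(2) F']] .
  then have WW: "\<beta>' * ?W = \<beta> * ?W'" using C CC b0 by (simp add: divide_simps mult.commute)
  have Wpos: "?W > 0" "?W' > 0" using orb_image_weight_pos g b by auto
  have W'S: "?W' \<le> orb_weight \<gamma>" using orb_image_weight_le[OF g(2), of \<beta>'] SS by simp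
  have "\<beta> * ?W < \<beta>' * ?W" using b Wpos by simp
  then have "?W < ?W'" using WW b0 by simp
  then have "?W < orb_weight \<gamma>" using W'S by simp
  then obtain k where k: "0 < k" "\<And>j. k \<le> j \<Longrightarrow> orb_image \<beta> \<gamma> j = 0"
    "?W = (\<Sum>j<k. 1 / \<gamma> ^ j)" "orb_weight \<gamma> = (\<Sum>j<k. 1 / \<gamma> ^ j) + 1 / \<gamma> ^ k"
    by (rule orb_image_weight_less[OF \<gamma>_def g(1) b(3)]) blast
  define a where "a = 1 / \<gamma> ^ k"
  have S: "orb_weight \<gamma> = ?W + a" using k by (simp add: a_def)
  have apos: "a > 0" using g by (simp add: a_def)
  have geo: "?W * (1 - 1 / \<gamma>) = 1 - a"
    using one_diff_power_eq[of "1 / \<gamma>" k] unfolding k(3) a_def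
    by (simp add: power_one_over mult.commute)
  \<comment> \<open>Here \<gamma> > 2 turns the geometric sum into the bound needed for
    \<open>weight_arith\<close>.\<close>
  have "?W * (1 / 2) \<le> ?W * (1 - 1 / \<gamma>)"
    using Wpos g2 by (intro mult_left_mono) (auto simp: field_simps)
  then have W2: "?W \<le> 2 * (1 - a)" using geo by simp
  have bb: "\<beta>' * ?W \<le> \<beta> * (?W + a)"
    unfolding WW using W'S S b0 by simp
  \<comment> \<open>\<open>a\<close> is the last term of W divided by \<gamma>. With \<gamma> = n
    \<beta> this gives \<beta> a \<le> W / n < W, hence \<beta>' < \<beta> + 1.\<close>
  have "a \<le> ?W / \<gamma>"
  proof -
    have w: "1 / \<gamma> ^ (k - 1) \<le> ?W"
      unfolding k(3) using k(1) g by (intro member_le_sum) auto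
    have "a = 1 / \<gamma> ^ (k - 1) / \<gamma>" using k(1) by (cases k) (auto simp: a_def)
    then show ?thesis using w g by (simp only:) (intro divide_right_mono; simp)
  qed
  then have "\<beta> * a \<le> \<beta> * (?W / \<gamma>)" using b0 by (intro mult_left_mono) auto
  also have "\<dots> = ?W / real n" using b0 n by (simp add: \<gamma>_def)
  also have "\<dots> \<le> ?W / 2" using n Wpos by (intro divide_left_mono) auto
  also have "\<dots> < ?W" using Wpos by simp
  finally have "\<beta>' * ?W < (\<beta> + 1) * ?W" using bb by (simp add: algebra_simps)
  then have b1: "\<beta>' < \<beta> + 1" using Wpos by simp
  define y where "y = frac \<beta>'"
  have yne: "y \<noteq> frac \<beta>"
  proof
    assume "y = frac \<beta>"
    then have "\<beta>' - \<beta> = of_int (\<lfloor>\<beta>'\<rfloor> - \<lfloor>\<beta>\<rfloor>)" by (simp add: y_def frac_def)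
    then have "0 < real_of_int (\<lfloor>\<beta>'\<rfloor> - \<lfloor>\<beta>\<rfloor>)" "real_of_int (\<lfloor>\<beta>'\<rfloor> - \<lfloor>\<beta>\<rfloor>) < 1" using b b1 by linarith+
    then show False unfolding of_int_0_less_iff of_int_less_1_iff by linarith
  qed
  have "\<beta>' \<notin> \<int>" using b Ints_subset_Rats by auto
  then have y: "0 < y" "y < 1" by (auto simp: y_def frac_lt_1)
  \<comment> \<open>The width keeps y - \<delta> and y + \<delta> inside [0,1] and makes the tent
    vanish at \<open>frac \<beta>\<close> and at 0.\<close>
  define \<delta> where "\<delta> = min \<bar>y - frac \<beta>\<bar> (min y (1 - y))"
  have \<delta>: "0 < \<delta>" "\<delta> \<le> y" "y + \<delta> \<le> 1" "\<delta> \<le> \<bar>y - frac \<beta>\<bar>" using y yne by (auto simp: \<delta>_def)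
  define E where "E = parry_const \<gamma> * (2 * F y - F (y - \<delta>) - F (y + \<delta>))"
  have s: "(\<lambda>j. tent \<delta> y (orb_image \<beta> \<gamma> j) / \<gamma> ^ j) sums (\<beta> * E)"
    "(\<lambda>j. tent \<delta> y (orb_image \<beta>' \<gamma>' j) / \<gamma>' ^ j) sums (\<beta>' * E)"
    using tent_sums[OF g(1) b0(1) F_def, of \<delta> y] tent_sums[OF g(2) b0(2) F', of \<delta> y] \<delta>
    by (auto simp: E_def CC mult.assoc)
  \<comment> \<open>For \<beta>' the image point of index 0 is y itself, the peak; the other terms
    are nonnegative.\<close>
  have "\<delta> = (\<Sum>j\<in>{0}. tent \<delta> y (orb_image \<beta>' \<gamma>' j) / \<gamma>' ^ j)"
    using \<delta> tent_peak[of \<delta> y] by (simp add: orb_image_def y_def)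
  also have "\<dots> \<le> \<beta>' * E"
    unfolding sums_unique[OF s(2)]
    by (rule sum_le_suminf[OF sums_summable[OF s(2)]]) (use g \<delta> tent_nonneg in auto)
  finally have E1: "\<delta> \<le> \<beta>' * E" .
  \<comment> \<open>For \<beta> the indices from k on contribute the tent at 0, and index 0 the tent
    at \<open>frac \<beta>\<close>; both vanish. The remaining weights add up to W - 1.\<close>
  have "\<beta> * E = (\<Sum>j<k. tent \<delta> y (orb_image \<beta> \<gamma> j) / \<gamma> ^ j)"
    unfolding sums_unique[OF s(1)]
    by (rule suminf_finite) (use \<delta> tent_eq_0[of \<delta> y 0] k(2) in auto)
  also have "\<dots> = (\<Sum>j\<in>{..<k} - {0}. tent \<delta> y (orb_image \<beta> \<gamma> j) / \<gamma> ^ j)"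
    using \<delta> k(1) tent_eq_0[of \<delta> y "frac \<beta>"]
    by (subst sum.remove[of _ 0]) (auto simp: orb_image_def)
  also have "\<dots> \<le> (\<Sum>j\<in>{..<k} - {0}. \<delta> * (1 / \<gamma> ^ j))"
    using g \<delta> tent_le by (intro sum_mono) (auto simp: divide_right_mono)
  also have "\<dots> = \<delta> * (?W - 1)"
    unfolding k(3) using k(1) by (subst (2) sum.remove[of _ 0]) (auto simp: sum_distrib_left)
  finally have E2: "\<beta> * E \<le> \<delta> * (?W - 1)" .
  have "\<delta> * \<beta> \<le> \<beta>' * (\<beta> * E)" using mult_right_mono[OF E1, of \<beta>] b0 by (simp add: mult_ac)
  also have "\<dots> \<le> \<beta>' * (\<delta> * (?W - 1))" using E2 b0 by (intro mult_left_mono) auto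
  finally have "\<delta> * \<beta> \<le> \<delta> * (\<beta>' * (?W - 1))" by (simp add: mult_ac)
  then have "\<beta> \<le> \<beta>' * (?W - 1)" using \<delta> by simp
  then show False using weight_arith[OF b0 Wpos(1) W2 apos] bb by simp
qed

theorem theorem3p4:
  fixes \<beta> \<beta>' :: real and n m :: nat
  assumes "\<beta> > 1" and "\<beta> \<notin> \<rat>" and "n \<ge> 2" and "m \<ge> 2"
    and "\<beta>' > 1" and "\<beta>' \<notin> \<rat>" and "\<beta>' \<noteq> \<beta>"
  shows "mu_alt \<beta> n \<noteq> mu_alt \<beta>' m"
proof
  assume eq: "mu_alt \<beta> n = mu_alt \<beta>' m"
  note mu = mu_comp_nat_left[OF assms(1,3)] mu_comp_nat_right[OF assms(1,3)]
    mu_comp_nat_left[OF assms(5,4)] mu_comp_nat_right[OF assms(5,4)]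
  have "mu_comp (real n) \<beta> = mu_comp (real m) \<beta>'" "mu_comp \<beta> (real n) = mu_comp \<beta>' (real m)"
    by (rule mu_alt_eq_imp_mu_comp_eq[OF _ _ _ _ eq]; simp add: mu)+
  then have e: "parry (real n * \<beta>) = parry (real m * \<beta>')"
    "distr (parry (real n * \<beta>)) unit_leb (T_map \<beta>) = distr (parry (real m * \<beta>')) unit_leb (T_map \<beta>')"
    unfolding mu .
  show False
  proof (cases "\<beta> < \<beta>'")
    case True
    then show False using no_common_measures_if_less[OF _ _ _ _ _ _ e] assms by simp
  next
    case False
    then show False using no_common_measures_if_less[OF _ _ _ _ _ _ e[symmetric]] assms by simp
  qed
qed

end
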